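(* Let $N\ge1$, $d\ge2$, $\kappa\ge0$, $T>0$, $\lambda>0$, and $x_i^0\in\mathbb S^{d-1}$ for $i\in[N]$. For $\mathbf u=(u_1,\dots,u_N)\in L^2([0,T];\mathbb R^d)^N$ let $\{x_i\}_{i=1}^N$ be the unique solution on $[0,T]$ of $$\dot x_i=\frac{\kappa}{N}\sum_{k=1}^N\big(x_k-\langle x_i,x_k\rangle x_i\big)+u_i-\langle u_i,x_i\rangle x_i,\qquad x_i(0)=x_i^0,$$ and define $$\tilde{\mathcal J}(\mathbf u):=\int_0^T\frac1N\sum_{i=1}^N\big(\|x_i(t)-\bar x(t)\|^2+\lambda\|u_i(t)\|^2\big)\,dt,\qquad \bar x:=\frac1N\sum_{j=1}^Nx_j.$$ Then there exists $\mathbf u^*\in L^2([0,T];\mathbb R^d)^N$, with corresponding trajectory $\{x_i^*\}_{i=1}^N$, such that $\tilde{\mathcal J}(\mathbf u^* )=\min_{\mathbf u\in L^2([0,T];\mathbb R^d)^N}\tilde{\mathcal J}(\mathbf u)$.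
   Context: $[N]:=\{1,\dots,N\}$; $\|\cdot\|$, $\langle\cdot,\cdot\rangle$ Euclidean norm and inner product on $\mathbb R^d$; $\mathbb S^{d-1}$ the unit sphere. For each $\mathbf u$ the state equation has a unique absolutely continuous (Carathéodory) solution on $[0,T]$ with $\|x_i(t)\|=1$, so $\tilde{\mathcal J}$ is well defined. *)

theory Defs
  imports "HOL-Analysis.Analysis"
begin

definition L2_on :: "real \<Rightarrow> (real \<Rightarrow> 'a::euclidean_space) \<Rightarrow> bool" where
  "L2_on T f \<longleftrightarrow>
     f \<in> borel_measurable (restrict_space lebesgue {0..T}) \<and>
     integrable (restrict_space lebesgue {0..T}) (\<lambda>t. (norm (f t))\<^sup>2)"

definition rhs :: "real \<Rightarrow> nat \<Rightarrow> (nat \<Rightarrow> real \<Rightarrow> 'a::euclidean_space)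
                   \<Rightarrow> (nat \<Rightarrow> real \<Rightarrow> 'a) \<Rightarrow> nat \<Rightarrow> real \<Rightarrow> 'a" where
  "rhs \<kappa> N u x i s =
     (\<kappa> / real N) *\<^sub>R (\<Sum>k<N. x k s - (inner (x i s) (x k s)) *\<^sub>R x i s)
     + u i s - (inner (u i s) (x i s)) *\<^sub>R x i s"

text \<open>Caratheodory solution on [0,T]: continuous, with the integrated form of the ODE
  (Lebesgue-integrable right-hand side), hence absolutely continuous.\<close>
definition is_solution :: "real \<Rightarrow> nat \<Rightarrow> real \<Rightarrow> (nat \<Rightarrow> 'a::euclidean_space)
                          \<Rightarrow> (nat \<Rightarrow> real \<Rightarrow> 'a) \<Rightarrow> (nat \<Rightarrow> real \<Rightarrow> 'a) \<Rightarrow> bool" where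
  "is_solution \<kappa> N T x0 u x \<longleftrightarrow>
     (\<forall>i<N. continuous_on {0..T} (x i) \<and> x i 0 = x0 i \<and>
        (\<forall>t\<in>{0..T}. set_integrable lebesgue {0..t} (rhs \<kappa> N u x i) \<and>
            x i t = x0 i + (LINT s:{0..t}|lebesgue. rhs \<kappa> N u x i s)))"

definition cost :: "nat \<Rightarrow> real \<Rightarrow> real \<Rightarrow> (nat \<Rightarrow> real \<Rightarrow> 'a::euclidean_space)
                    \<Rightarrow> (nat \<Rightarrow> real \<Rightarrow> 'a) \<Rightarrow> real" where
  "cost N T lam u x =
     (LINT t:{0..T}|lebesgue. (1 / real N) *
        (\<Sum>i<N. (norm (x i t - (1 / real N) *\<^sub>R (\<Sum>j<N. x j t)))\<^sup>2 + lam * (norm (u i t))\<^sup>2))"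

end

theory Submission
  imports Defs "HOL-Complex_Analysis.Great_Picard"
begin

text \<open>Direct method. The control that cancels the coupling keeps every point at rest, so admissible
  pairs exist and there is a minimizing sequence. Trajectories stay on the sphere, because
  \<open>(norm x)\<^sup>2 - 1\<close> solves a linear homogeneous integral equation, and the \<open>L\<^sup>2\<close> bound on the controls makes
  them equicontinuous; Arzela--Ascoli gives a uniform limit \<open>X\<close> along a subsequence. Instead of
  weak compactness in \<open>L\<^sup>2\<close>, midpoint combinations of the tails of the controls with nearly minimal energy
  are used: by the parallelogram law they form a Cauchy sequence, and their limit \<open>w\<close> has energy at most
  that of the controls in the limit. Since the state equation is affine in the control, \<open>X\<close> is
  the trajectory of \<open>w\<close>.\<close>

section \<open>Square integrable functions\<close>

text \<open>The control-to-trajectory map is nonlinear: a combination of controls does not come with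
  the same combination of trajectories, and the averaged controls \<open>v k\<close> carry no
  trajectories in the argument. Hence the trajectories are made to converge before any averaging.
  Their uniform convergence settles the dispersion part of the cost, and since the total cost tends
  to the infimum \<open>c\<close>, the energies are forced to tend to one number \<open>q\<close>.
  What remains is an upper bound on a single energy, and the least energies of the tails cannot
  exceed \<open>q\<close>, because each tail contains its own first control. Convergence of the
  averages in L1 is enough: along a fixed curve on the sphere the control enters the equation
  through a linear map that at most doubles its norm. Passages between L1 and L2 bounds use Young's
  inequality with a free weight, chosen so that one of the two resulting terms is small
  uniformly.\<close>

definition square_integrable :: "'b measure \<Rightarrow> ('b \<Rightarrow> 'a::euclidean_space) \<Rightarrow> bool" where
  "square_integrable M f \<longleftrightarrow> f \<in> borel_measurable M \<and> integrable M (\<lambda>t. (norm (f t))\<^sup>2)"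

lemma square_integrable_add:
  assumes "square_integrable M f" "square_integrable M g"
  shows "square_integrable M (\<lambda>t. f t + g t)"
proof -
  have [measurable]: "f \<in> borel_measurable M" "g \<in> borel_measurable M"
    using assms by (auto simp: square_integrable_def)
  have *: "(norm (a + b))\<^sup>2 \<le> 2 * (norm a)\<^sup>2 + 2 * (norm b)\<^sup>2" for a b :: "_::euclidean_space"
    using zero_le_power2[of "norm (a - b)"]
    by (simp add: power2_norm_eq_inner algebra_simps inner_commute)
  have "integrable M (\<lambda>t. (norm (f t + g t))\<^sup>2)"
    by (rule Bochner_Integration.integrable_bound[where f="\<lambda>t. 2 * (norm (f t))\<^sup>2 + 2 * (norm (g t))\<^sup>2"])
      (use assms * in \<open>auto simp: square_integrable_def\<close>)
  then show ?thesis by (simp add: square_integrable_def)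
qed

lemma square_integrable_scaleR:
  assumes "square_integrable M f"
  shows "square_integrable M (\<lambda>t. c *\<^sub>R f t)"
  using assms by (auto simp: square_integrable_def power_mult_distrib)

lemma square_integrable_diff:
  assumes "square_integrable M f" "square_integrable M g"
  shows "square_integrable M (\<lambda>t. f t - g t)"
  using square_integrable_add[OF assms(1) square_integrable_scaleR[OF assms(2), of "-1"]] by simp

lemma (in finite_measure) square_integrable_imp_integrable:
  assumes "square_integrable M f"
  shows "integrable M f"
proof (rule Bochner_Integration.integrable_bound[where f="\<lambda>t. 1 + (norm (f t))\<^sup>2"])
  have "a \<le> 1 + a\<^sup>2" for a :: real
    using zero_le_power2[of "a - 1/2"] by (simp add: power2_eq_square algebra_simps)
  then show "AE x in M. norm (f x) \<le> norm (1 + (norm (f x))\<^sup>2)"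
    by (auto simp: add_nonneg_nonneg abs_of_nonneg)
qed (use assms in \<open>auto simp: square_integrable_def\<close>)

text \<open>Young's inequality in place of Cauchy-Schwarz. The weight \<open>a\<close> is free: a
  small \<open>a\<close> controls the term with the total mass, after which a small energy controls
  the other one.\<close>

lemma (in finite_measure) integral_norm_le_square:
  assumes "square_integrable M f" "a > 0"
  shows "(\<integral>t. norm (f t) \<partial>M) \<le> ((\<integral>t. (norm (f t))\<^sup>2 \<partial>M) / a + a * measure M (space M)) / 2"
proof -
  have *: "r \<le> (r\<^sup>2 / a + a) / 2" for r
    using zero_le_power2[of "r - a"] assms(2)
    by (simp add: power2_eq_square field_simps)
  have "(\<integral>t. norm (f t) \<partial>M) \<le> (\<integral>t. ((norm (f t))\<^sup>2 / a + a) / 2 \<partial>M)"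
    using assms square_integrable_imp_integrable[OF assms(1)] *
    by (intro integral_mono) (auto simp: square_integrable_def)
  also have "\<dots> = ((\<integral>t. (norm (f t))\<^sup>2 \<partial>M) / a + a * measure M (space M)) / 2"
    using assms by (simp add: square_integrable_def)
  finally show ?thesis .
qed

text \<open>Midpoints suffice for the parallelogram argument below, so they replace arbitrary convex
  combinations of the tail \<open>u n, u (n + 1), \<dots>\<close>.\<close>

inductive_set tail_midpoints :: "(nat \<Rightarrow> 'i \<Rightarrow> 'b \<Rightarrow> 'a::real_vector) \<Rightarrow> nat \<Rightarrow> ('i \<Rightarrow> 'b \<Rightarrow> 'a) set"
  for u n where
    base: "n \<le> m \<Longrightarrow> u m \<in> tail_midpoints u n"
  | mid: "v \<in> tail_midpoints u n \<Longrightarrow> w \<in> tail_midpoints u n \<Longrightarrow>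
      (\<lambda>i t. (1/2) *\<^sub>R (v i t + w i t)) \<in> tail_midpoints u n"

lemma tail_midpoints_antimono:
  assumes "v \<in> tail_midpoints u n" "m \<le> n"
  shows "v \<in> tail_midpoints u m"
  using assms by induction (auto intro: tail_midpoints.intros)

lemma tail_midpoints_square_integrable:
  assumes "v \<in> tail_midpoints u n" "\<And>m. square_integrable M (u m i)"
  shows "square_integrable M (v i)"
  using assms by induction (auto intro: square_integrable_add square_integrable_scaleR)

text \<open>A ball around \<open>L\<close> is closed under midpoints. Once it contains
  \<open>\<phi> (u n)\<close> for all late \<open>n\<close>, it contains the value of
  \<open>\<phi>\<close> on everything built from a late tail.\<close>

lemma tail_midpoints_tendsto:
  fixes \<phi> :: "('i \<Rightarrow> 'b \<Rightarrow> 'a::real_vector) \<Rightarrow> 'c::real_normed_vector"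
  assumes v: "\<And>k. v k \<in> tail_midpoints u k"
    and lim: "(\<lambda>n. \<phi> (u n)) \<longlonglongrightarrow> L"
    and mid: "\<And>n v w. v \<in> tail_midpoints u n \<Longrightarrow> w \<in> tail_midpoints u n \<Longrightarrow>
      \<phi> (\<lambda>i t. (1/2) *\<^sub>R (v i t + w i t)) = (1/2) *\<^sub>R (\<phi> v + \<phi> w)"
  shows "(\<lambda>k. \<phi> (v k)) \<longlonglongrightarrow> L"
proof (rule LIMSEQ_I)
  fix e :: real assume "e > 0"
  then obtain n0 where n0: "\<And>n. n \<ge> n0 \<Longrightarrow> norm (\<phi> (u n) - L) < e"
    using LIMSEQ_D[OF lim] by metis
  have "norm (\<phi> w - L) < e" if "w \<in> tail_midpoints u n" "n \<ge> n0" for w n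
    using that
  proof induction
    case (base m)
    then show ?case using n0 by auto
  next
    case (mid v w)
    have "\<phi> (\<lambda>i t. (1/2) *\<^sub>R (v i t + w i t)) - L = (1/2) *\<^sub>R ((\<phi> v - L) + (\<phi> w - L))"
      using mid assms(3) by (simp add: algebra_simps flip: scaleR_add_left)
    also have "norm \<dots> \<le> (1/2) * (norm (\<phi> v - L) + norm (\<phi> w - L))"
      unfolding norm_scaleR using norm_triangle_ineq by (intro mult_mono) auto
    also have "\<dots> < e"
      using mid by simp
    finally show ?case .
  qed
  then show "\<exists>no. \<forall>n\<ge>no. norm (\<phi> (v n) - L) < e"
    using v by blast
qed

section \<open>Energy, the parallelogram law and compactness by averaging\<close>

definition energy :: "'b measure \<Rightarrow> 'i set \<Rightarrow> ('i \<Rightarrow> 'b \<Rightarrow> 'a::euclidean_space) \<Rightarrow> real" where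
  "energy M I v = (\<Sum>i\<in>I. \<integral>t. (norm (v i t))\<^sup>2 \<partial>M)"

lemma energy_nonneg: "energy M I v \<ge> 0"
  by (simp add: energy_def sum_nonneg)

lemma energy_component_le:
  assumes "finite I" "i \<in> I"
  shows "(\<integral>t. (norm (v i t))\<^sup>2 \<partial>M) \<le> energy M I v"
  unfolding energy_def using assms by (intro member_le_sum) auto

text \<open>Used to bound distances: two controls of nearly minimal energy are close as soon as
  their midpoint cannot have much less energy than they have.\<close>

lemma energy_parallelogram:
  assumes "\<And>i. i \<in> I \<Longrightarrow> square_integrable M (v i)" "\<And>i. i \<in> I \<Longrightarrow> square_integrable M (w i)"
  shows "energy M I (\<lambda>i t. v i t - w i t)
    = 2 * energy M I v + 2 * energy M I w - 4 * energy M I (\<lambda>i t. (1/2) *\<^sub>R (v i t + w i t))"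
proof -
  have "(\<integral>t. (norm (v i t - w i t))\<^sup>2 \<partial>M) = 2 * (\<integral>t. (norm (v i t))\<^sup>2 \<partial>M)
     + 2 * (\<integral>t. (norm (w i t))\<^sup>2 \<partial>M) - 4 * (\<integral>t. (norm ((1/2) *\<^sub>R (v i t + w i t)))\<^sup>2 \<partial>M)" if "i \<in> I" for i
  proof -
    have *: "(norm (a - b))\<^sup>2 = 2 * (norm a)\<^sup>2 + 2 * (norm b)\<^sup>2 - 4 * (norm ((1/2) *\<^sub>R (a + b)))\<^sup>2" for a b :: "_::euclidean_space"
      by (simp add: power2_norm_eq_inner inner_commute algebra_simps)
    have "square_integrable M (\<lambda>t. (1/2) *\<^sub>R (v i t + w i t))"
      using that assms by (intro square_integrable_scaleR square_integrable_add) auto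
    then show ?thesis
      unfolding * using assms that by (simp add: square_integrable_def)
  qed
  then show ?thesis
    unfolding energy_def by (simp add: sum.distrib sum_subtractf sum_distrib_left)
qed

text \<open>Riesz-Fischer: a subsequence converges almost everywhere, and Fatou's lemma carries the
  Cauchy estimate over to its limit.\<close>

lemma L1_complete:
  fixes v :: "nat \<Rightarrow> 'b \<Rightarrow> 'a::{banach, second_countable_topology}"
  assumes int: "\<And>n. integrable M (v n)"
    and cauchy: "\<And>e. e > 0 \<Longrightarrow> \<exists>K. \<forall>k\<ge>K. \<forall>l\<ge>K. (\<integral>t. norm (v k t - v l t) \<partial>M) < e"
  obtains w where "integrable M w" "(\<lambda>k. \<integral>t. norm (v k t - w t) \<partial>M) \<longlonglongrightarrow> 0"
proof -
  have [measurable]: "v n \<in> borel_measurable M" for n using int by auto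
  obtain r where r: "strict_mono r" and "AE t in M. Cauchy (\<lambda>k. v (r k) t)"
    using cauchy_L1_AE_cauchy_subseq[OF int cauchy] by blast
  define w where "w t = lim (\<lambda>k. v (r k) t)" for t
  have [measurable]: "w \<in> borel_measurable M"
    unfolding w_def by measurable
  have conv: "AE t in M. (\<lambda>k. v (r k) t) \<longlonglongrightarrow> w t"
    using \<open>AE t in M. Cauchy _\<close>
    by eventually_elim (simp add: w_def Cauchy_convergent_iff convergent_LIMSEQ_iff)
  \<comment> \<open>Only the second index runs along the subsequence; \<open>k\<close> stays
    arbitrary, so the whole sequence converges to \<open>w\<close>.\<close>
  have bound: "(\<integral>\<^sup>+t. norm (v k t - w t) \<partial>M) \<le> ennreal e"
    if K: "\<forall>k\<ge>K. \<forall>l\<ge>K. (\<integral>t. norm (v k t - v l t) \<partial>M) < e" and "k \<ge> K" for e K k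
  proof -
    have "(\<integral>\<^sup>+t. norm (v k t - w t) \<partial>M) = (\<integral>\<^sup>+t. liminf (\<lambda>l. ennreal (norm (v k t - v (r l) t))) \<partial>M)"
    proof (rule nn_integral_cong_AE, use conv in eventually_elim)
      case (elim t)
      then have "(\<lambda>l. ennreal (norm (v k t - v (r l) t))) \<longlonglongrightarrow> ennreal (norm (v k t - w t))"
        by (intro tendsto_ennrealI tendsto_intros)
      then show ?case by (intro lim_imp_Liminf[symmetric]) auto
    qed
    also have "\<dots> \<le> liminf (\<lambda>l. \<integral>\<^sup>+t. norm (v k t - v (r l) t) \<partial>M)"
      by (intro nn_integral_liminf) measurable
    also have "\<dots> \<le> ennreal e"
    proof (rule Liminf_le)
      have "\<forall>l\<ge>K. (\<integral>\<^sup>+t. norm (v k t - v (r l) t) \<partial>M) \<le> ennreal e"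
      proof (intro allI impI)
        fix l assume "l \<ge> K"
        then have "r l \<ge> K" using seq_suble[OF r, of l] by linarith
        have "(\<integral>\<^sup>+t. norm (v k t - v (r l) t) \<partial>M) = ennreal (\<integral>t. norm (v k t - v (r l) t) \<partial>M)"
          by (intro nn_integral_eq_integral) (use int in auto)
        also have "\<dots> \<le> ennreal e"
          using K \<open>k \<ge> K\<close> \<open>r l \<ge> K\<close> by (intro ennreal_leI) (simp add: less_imp_le)
        finally show "(\<integral>\<^sup>+t. norm (v k t - v (r l) t) \<partial>M) \<le> ennreal e" .
      qed
      then show "\<forall>\<^sub>F l in sequentially. (\<integral>\<^sup>+t. norm (v k t - v (r l) t) \<partial>M) \<le> ennreal e"
        unfolding eventually_sequentially by blast
    qed simp
    finally show ?thesis .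
  qed
  obtain K1 where K1: "\<forall>k\<ge>K1. \<forall>l\<ge>K1. (\<integral>t. norm (v k t - v l t) \<partial>M) < 1"
    using cauchy[of 1] by auto
  have "integrable M (\<lambda>t. v K1 t - w t)"
    using bound[OF K1 order_refl] by (intro integrableI_bounded) (auto simp: order_le_less_trans)
  then have w: "integrable M w"
    using Bochner_Integration.integrable_diff[OF int[of K1], of "\<lambda>t. v K1 t - w t"] by simp
  have "(\<lambda>k. \<integral>t. norm (v k t - w t) \<partial>M) \<longlonglongrightarrow> 0"
  proof (rule LIMSEQ_I)
    fix e :: real assume "e > 0"
    then obtain K where K: "\<forall>k\<ge>K. \<forall>l\<ge>K. (\<integral>t. norm (v k t - v l t) \<partial>M) < e/2"
      using cauchy[of "e/2"] by auto
    have "(\<integral>t. norm (v k t - w t) \<partial>M) \<le> e/2" if "k \<ge> K" for k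
    proof -
      have "ennreal (\<integral>t. norm (v k t - w t) \<partial>M) = (\<integral>\<^sup>+t. norm (v k t - w t) \<partial>M)"
        by (intro nn_integral_eq_integral[symmetric]) (use int w in auto)
      with bound[OF K that] \<open>e > 0\<close> show ?thesis
        by (metis ennreal_le_iff half_gt_zero less_imp_le)
    qed
    then show "\<exists>no. \<forall>k\<ge>no. norm ((\<integral>t. norm (v k t - w t) \<partial>M) - 0) < e"
      using \<open>e > 0\<close> by (intro exI[of _ K]) (force simp: abs_of_nonneg)
  qed
  with that w show ?thesis by blast
qed

text \<open>Fatou's lemma along an almost everywhere convergent subsequence. The energies themselves
  need not converge; upper bounds \<open>c k\<close> with a limit suffice.\<close>

lemma energy_lower_semicontinuous:
  fixes v :: "nat \<Rightarrow> 'i \<Rightarrow> 'b \<Rightarrow> 'a::euclidean_space"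
  assumes I: "finite I"
    and v: "\<And>k i. i \<in> I \<Longrightarrow> square_integrable M (v k i)" "\<And>k i. i \<in> I \<Longrightarrow> integrable M (v k i)"
    and w: "\<And>i. i \<in> I \<Longrightarrow> integrable M (w i)"
    and conv: "\<And>i. i \<in> I \<Longrightarrow> (\<lambda>k. \<integral>t. norm (v k i t - w i t) \<partial>M) \<longlonglongrightarrow> 0"
    and le: "\<And>k. energy M I (v k) \<le> c k" and c: "c \<longlonglongrightarrow> q"
  shows "\<And>i. i \<in> I \<Longrightarrow> square_integrable M (w i)" "energy M I w \<le> q"
proof -
  have vm[measurable]: "v k i \<in> borel_measurable M" if "i \<in> I" for k i
    using v that by auto
  have wm[measurable]: "w i \<in> borel_measurable M" if "i \<in> I" for i
    using w that by auto
  \<comment> \<open>Summing over \<open>I\<close> yields one subsequence that works for all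
    components at once.\<close>
  define g where "g k t = (\<Sum>i\<in>I. norm (v k i t - w i t))" for k t
  have "(\<lambda>k. \<integral>t. g k t \<partial>M) = (\<lambda>k. \<Sum>i\<in>I. \<integral>t. norm (v k i t - w i t) \<partial>M)"
    unfolding g_def by (intro ext Bochner_Integration.integral_sum) (use v w in auto)
  moreover have "\<dots> \<longlonglongrightarrow> 0"
    using conv by (intro tendsto_null_sum)
  moreover have "norm (g k t) = g k t" for k t
    by (simp add: g_def sum_nonneg)
  ultimately have "(\<lambda>k. \<integral>t. norm (g k t) \<partial>M) \<longlonglongrightarrow> 0"
    by simp
  moreover have "integrable M (g k)" for k
    unfolding g_def using v w by (intro Bochner_Integration.integrable_sum) auto
  ultimately obtain r where r: "strict_mono r" and "AE t in M. (\<lambda>k. g (r k) t) \<longlonglongrightarrow> 0"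
    using tendsto_L1_AE_subseq[of M g] by blast
  \<comment> \<open>\<open>ennreal\<close> truncates negative numbers to 0, so the final return to
    the reals requires this sign.\<close>
  have q: "q \<ge> 0"
    using c by (rule LIMSEQ_le_const) (use le energy_nonneg order_trans in blast)
  have "(\<integral>\<^sup>+t. ennreal (\<Sum>i\<in>I. (norm (w i t))\<^sup>2) \<partial>M)
      = (\<integral>\<^sup>+t. liminf (\<lambda>k. ennreal (\<Sum>i\<in>I. (norm (v (r k) i t))\<^sup>2)) \<partial>M)"
  proof (rule nn_integral_cong_AE, use \<open>AE t in M. _\<close> in eventually_elim)
    case (elim t)
    have "(\<lambda>k. v (r k) i t) \<longlonglongrightarrow> w i t" if "i \<in> I" for i
    proof -
      have "norm (v (r k) i t - w i t) \<le> g (r k) t" for k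
        unfolding g_def using I that by (intro member_le_sum) auto
      then have "(\<lambda>k. norm (v (r k) i t - w i t)) \<longlonglongrightarrow> 0"
        by (intro tendsto_sandwich[OF _ _ tendsto_const elim]) auto
      then show ?thesis using LIM_zero_iff tendsto_norm_zero_iff by blast
    qed
    then have "(\<lambda>k. ennreal (\<Sum>i\<in>I. (norm (v (r k) i t))\<^sup>2)) \<longlonglongrightarrow> ennreal (\<Sum>i\<in>I. (norm (w i t))\<^sup>2)"
      by (intro tendsto_ennrealI tendsto_intros)
    then show ?case by (intro lim_imp_Liminf[symmetric]) auto
  qed
  also have "\<dots> \<le> liminf (\<lambda>k. \<integral>\<^sup>+t. ennreal (\<Sum>i\<in>I. (norm (v (r k) i t))\<^sup>2) \<partial>M)"
    by (intro nn_integral_liminf) measurable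
  also have "\<dots> = liminf (\<lambda>k. ennreal (energy M I (v (r k))))"
  proof -
    have "(\<integral>\<^sup>+t. ennreal (\<Sum>i\<in>I. (norm (v k i t))\<^sup>2) \<partial>M) = ennreal (energy M I (v k))" for k
    proof -
      have int: "integrable M (\<lambda>t. (norm (v k i t))\<^sup>2)" if "i \<in> I" for i
        using v that by (auto simp: square_integrable_def)
      then have "(\<integral>\<^sup>+t. ennreal (\<Sum>i\<in>I. (norm (v k i t))\<^sup>2) \<partial>M) = ennreal (\<integral>t. (\<Sum>i\<in>I. (norm (v k i t))\<^sup>2) \<partial>M)"
        by (intro nn_integral_eq_integral Bochner_Integration.integrable_sum) (auto simp: sum_nonneg)
      then show ?thesis using int by (simp add: energy_def)
    qed
    then show ?thesis by simp
  qed
  also have "\<dots> \<le> liminf (\<lambda>k. ennreal (c (r k)))"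
    by (intro Liminf_mono always_eventually) (use le in \<open>auto intro: ennreal_leI\<close>)
  also have "\<dots> = ennreal q"
    using tendsto_ennrealI[OF LIMSEQ_subseq_LIMSEQ[OF c r]]
    by (intro lim_imp_Liminf) (auto simp: o_def)
  finally have le_q: "(\<integral>\<^sup>+t. ennreal (\<Sum>i\<in>I. (norm (w i t))\<^sup>2) \<partial>M) \<le> ennreal q" .
  have int: "integrable M (\<lambda>t. (norm (w i t))\<^sup>2)" if "i \<in> I" for i
  proof (rule integrableI_bounded)
    have "(norm (w i t))\<^sup>2 \<le> (\<Sum>i\<in>I. (norm (w i t))\<^sup>2)" for t
      using I that by (intro member_le_sum) auto
    then have "(\<integral>\<^sup>+t. ennreal (norm ((norm (w i t))\<^sup>2)) \<partial>M) \<le> (\<integral>\<^sup>+t. ennreal (\<Sum>i\<in>I. (norm (w i t))\<^sup>2) \<partial>M)"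
      by (intro nn_integral_mono ennreal_leI) simp
    with le_q show "(\<integral>\<^sup>+t. ennreal (norm ((norm (w i t))\<^sup>2)) \<partial>M) < \<infinity>"
      by (simp add: le_less_trans[OF order_trans])
  qed (use that in measurable)
  then show "\<And>i. i \<in> I \<Longrightarrow> square_integrable M (w i)"
    using wm by (auto simp: square_integrable_def)
  have "(\<integral>\<^sup>+t. ennreal (\<Sum>i\<in>I. (norm (w i t))\<^sup>2) \<partial>M) = ennreal (\<integral>t. (\<Sum>i\<in>I. (norm (w i t))\<^sup>2) \<partial>M)"
    using int by (intro nn_integral_eq_integral Bochner_Integration.integrable_sum) (auto simp: sum_nonneg)
  with le_q int q show "energy M I w \<le> q"
    by (simp add: energy_def)
qed

text \<open>The Hilbert space argument for the point of least norm in a convex set, applied to the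
  decreasing family of tails: elements of nearly least energy in late tails form a Cauchy sequence,
  although the \<open>u n\<close> may oscillate.\<close>

lemma (in finite_measure) weak_compactness:
  fixes u :: "nat \<Rightarrow> 'i \<Rightarrow> 'a \<Rightarrow> 'c::euclidean_space"
  assumes I: "finite I" and u: "\<And>n i. i \<in> I \<Longrightarrow> square_integrable M (u n i)"
    and lim: "(\<lambda>n. energy M I (u n)) \<longlonglongrightarrow> q"
  obtains v w where "\<And>k. v k \<in> tail_midpoints u k"
    "\<And>i. i \<in> I \<Longrightarrow> square_integrable M (w i)" "energy M I w \<le> q"
    "\<And>i. i \<in> I \<Longrightarrow> (\<lambda>k. \<integral>t. norm (v k i t - w i t) \<partial>M) \<longlonglongrightarrow> 0"
proof -
  let ?E = "energy M I"
  have sq: "square_integrable M (v i)" if "v \<in> tail_midpoints u n" "i \<in> I" for v n i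
    using tail_midpoints_square_integrable[OF that(1)] u that(2) by blast
  define \<sigma> where "\<sigma> n = Inf (?E ` tail_midpoints u n)" for n
  have bdd: "bdd_below (?E ` tail_midpoints u n)" for n
    by (rule bdd_belowI[of _ 0]) (auto simp: energy_nonneg)
  have \<sigma>_le: "\<sigma> n \<le> ?E v" if "v \<in> tail_midpoints u n" for n v
    unfolding \<sigma>_def using that bdd by (intro cInf_lower) auto
  \<comment> \<open>Later tails are smaller sets, so their infima increase; the bound on the
    energies of \<open>u n\<close> makes them converge.\<close>
  have \<sigma>_mono: "incseq \<sigma>"
    unfolding incseq_def
  proof (intro allI impI)
    fix m n :: nat assume "m \<le> n"
    then show "\<sigma> m \<le> \<sigma> n"
      unfolding \<sigma>_def[of n]
      by (intro cInf_greatest) (auto intro: tail_midpoints.base \<sigma>_le tail_midpoints_antimono)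
  qed
  obtain B where "\<And>n. ?E (u n) \<le> B"
    using convergent_imp_bounded[OF lim] by (metis abs_le_D1 bounded_iff rangeI real_norm_def)
  then have "\<sigma> n \<le> B" for n
    using \<sigma>_le[of "u n" n] by (meson order_trans order_refl tail_midpoints.base)
  then obtain s where s: "\<sigma> \<longlonglongrightarrow> s" "\<And>n. \<sigma> n \<le> s"
    using incseq_convergent[OF \<sigma>_mono] by metis
  have "s \<le> q"
    using \<sigma>_le by (intro LIMSEQ_le[OF s(1) lim]) (auto intro: tail_midpoints.base)
  \<comment> \<open>The tail must start late enough that its infimum is close to \<open>s\<close>
    from below; only then does an energy close to \<open>s\<close> from above count as nearly
    minimal.\<close>
  have "\<exists>n v. n \<ge> k \<and> s - 1 / Suc k < \<sigma> n \<and> v \<in> tail_midpoints u n \<and> ?E v < s + 1 / Suc k" for k :: nat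
  proof -
    have "\<forall>\<^sub>F n in sequentially. s - 1 / Suc k < \<sigma> n"
      using s(1) by (rule order_tendstoD) simp
    with eventually_ge_at_top[of k] have "\<forall>\<^sub>F n in sequentially. n \<ge> k \<and> s - 1 / Suc k < \<sigma> n"
      by eventually_elim auto
    then obtain n where n: "n \<ge> k" "s - 1 / Suc k < \<sigma> n"
      using eventually_happens'[OF sequentially_bot] by blast
    have "\<sigma> n < s + 1 / Suc k"
      using s(2)[of n] by (rule le_less_trans) simp
    then obtain v where "v \<in> tail_midpoints u n" "?E v < s + 1 / Suc k"
      unfolding \<sigma>_def using cInf_lessD[of "?E ` tail_midpoints u n"] tail_midpoints.base[of n n u] by blast
    with n show ?thesis by blast
  qed
  then obtain \<nu> v where \<nu>: "\<And>k. \<nu> k \<ge> k" "\<And>k. s - 1 / Suc k < \<sigma> (\<nu> k)"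
    and v: "\<And>k. v k \<in> tail_midpoints u (\<nu> k)" "\<And>k. ?E (v k) < s + 1 / Suc k"
    by metis
  have v_sq: "square_integrable M (v k i)" if "i \<in> I" for k i
    using sq v(1) that by blast
  \<comment> \<open>With \<open>\<delta> = 1 / Suc K\<close>, the parallelogram law gives at most
    \<open>2 * (s + \<delta>) + 2 * (s + \<delta>) - 4 * (s - \<delta>) = 8 *
    \<delta>\<close>.\<close>
  have dist_le: "?E (\<lambda>i t. v k i t - v l i t) \<le> 8 / Suc K" if "k \<ge> K" "l \<ge> K" for k l K
  proof -
    \<comment> \<open>The larger of the two tails contains both elements, hence their midpoint, and
      its infimum still exceeds \<open>s - 1 / Suc K\<close> because \<open>m\<close> is one of the
      two indices.\<close>
    define m where "m = min (\<nu> k) (\<nu> l)"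
    have inv: "1 / Suc k \<le> 1 / Suc K" "1 / Suc l \<le> 1 / Suc K"
      using that by (auto simp: field_simps)
    have "s - 1 / Suc K < \<sigma> m"
      using \<nu>(2)[of k] \<nu>(2)[of l] inv unfolding m_def min_def by auto
    moreover have "v k \<in> tail_midpoints u m" "v l \<in> tail_midpoints u m"
      using v(1) tail_midpoints_antimono unfolding m_def by (metis min.cobounded1, metis min.cobounded2)
    then have "\<sigma> m \<le> ?E (\<lambda>i t. (1/2) *\<^sub>R (v k i t + v l i t))"
      by (intro \<sigma>_le tail_midpoints.mid)
    ultimately show ?thesis
      using energy_parallelogram[of I M "v k" "v l"] v_sq v(2)[of k] v(2)[of l] inv by auto
  qed
  have cauchy: "\<exists>K. \<forall>k\<ge>K. \<forall>l\<ge>K. (\<integral>t. norm (v k i t - v l i t) \<partial>M) < e" if "i \<in> I" "e > 0" for i e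
  proof -
    \<comment> \<open>The added 1 keeps \<open>\<mu>\<close> positive on a null space. With
      \<open>a = e / \<mu>\<close> the mass term is at most \<open>e\<close>, and \<open>K\<close>
      is taken so large that the energy term is below \<open>e\<close>; their half-sum is below
      \<open>e\<close>.\<close>
    define \<mu> where "\<mu> = measure M (space M) + 1"
    have "\<mu> > 0" by (simp add: \<mu>_def add_nonneg_pos)
    define a where "a = e / \<mu>"
    have "a > 0" using \<open>\<mu> > 0\<close> \<open>e > 0\<close> by (simp add: a_def)
    obtain K :: nat where "8 / (a * e) < Suc K"
      using reals_Archimedean2 by (metis lessI less_trans of_nat_less_iff)
    then have "8 < Suc K * (a * e)"
      using \<open>a > 0\<close> \<open>e > 0\<close> by (simp only: pos_divide_less_eq mult_pos_pos)
    then have K: "8 / Suc K / a < e"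
      using \<open>a > 0\<close> by (simp only: divide_divide_eq_left pos_divide_less_eq mult_pos_pos of_nat_0_less_iff zero_less_Suc ac_simps)
    have half: "(z + e) / 2 < e" if "z < e" for z
      using that by simp
    have "(\<integral>t. norm (v k i t - v l i t) \<partial>M) < e" if "k \<ge> K" "l \<ge> K" for k l
    proof -
      have le1: "(\<integral>t. norm (v k i t - v l i t) \<partial>M)
        \<le> ((\<integral>t. (norm (v k i t - v l i t))\<^sup>2 \<partial>M) / a + a * measure M (space M)) / 2"
        using v_sq \<open>i \<in> I\<close> \<open>a > 0\<close> by (intro integral_norm_le_square square_integrable_diff) auto
      have "(\<integral>t. (norm (v k i t - v l i t))\<^sup>2 \<partial>M) \<le> 8 / Suc K"
        using energy_component_le[OF I \<open>i \<in> I\<close>, of M "\<lambda>i t. v k i t - v l i t"] dist_le[OF that] by linarith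
      then have le2: "(\<integral>t. (norm (v k i t - v l i t))\<^sup>2 \<partial>M) / a \<le> 8 / Suc K / a"
        using \<open>a > 0\<close> by (intro divide_right_mono) auto
      have le3: "a * measure M (space M) \<le> e"
        using \<open>\<mu> > 0\<close> \<open>e > 0\<close> unfolding a_def \<mu>_def by (simp add: field_simps)
      have "(\<integral>t. norm (v k i t - v l i t) \<partial>M) \<le> (8 / Suc K / a + e) / 2"
        by (rule order_trans[OF le1 divide_right_mono[OF add_mono[OF le2 le3]]]) simp
      also have "\<dots> < e" by (rule half[OF K])
      finally show ?thesis .
    qed
    then show ?thesis by blast
  qed
  have v_int: "integrable M (v k i)" if "i \<in> I" for k i
    using v_sq that square_integrable_imp_integrable by blast
  have "\<forall>i\<in>I. \<exists>w. integrable M w \<and> (\<lambda>k. \<integral>t. norm (v k i t - w t) \<partial>M) \<longlonglongrightarrow> 0"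
    by (intro ballI, rule L1_complete[OF v_int cauchy]) auto
  then obtain w where w: "\<And>i. i \<in> I \<Longrightarrow> integrable M (w i)"
      "\<And>i. i \<in> I \<Longrightarrow> (\<lambda>k. \<integral>t. norm (v k i t - w i t) \<partial>M) \<longlonglongrightarrow> 0"
    by (auto dest!: bchoice)
  have c: "(\<lambda>k. s + 1 / Suc k) \<longlonglongrightarrow> s"
    using tendsto_add[OF tendsto_const LIMSEQ_Suc[OF lim_1_over_n], of s] by simp
  have le: "?E (v k) \<le> s + 1 / Suc k" for k using v(2) by (rule less_imp_le)
  note lsc = energy_lower_semicontinuous[of I M v w "\<lambda>k. s + 1 / Suc k" s]
  show ?thesis
  proof (rule that)
    show "v k \<in> tail_midpoints u k" for k
      by (rule tail_midpoints_antimono[OF v(1) \<nu>(1)])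
    show "?E w \<le> q" by (rule order_trans[OF lsc(2) \<open>s \<le> q\<close>]; fact I v_sq v_int w le c)
    show "square_integrable M (w i)" if "i \<in> I" for i
      by (rule lsc(1)[OF _ _ _ _ _ _ _ that]; fact I v_sq v_int w le c)
    show "(\<lambda>k. \<integral>t. norm (v k i t - w i t) \<partial>M) \<longlonglongrightarrow> 0" if "i \<in> I" for i
      using that by (rule w(2))
  qed
qed

section \<open>Absolutely continuous curves\<close>

lemma absolutely_integrable_continuous_product:
  fixes h :: "'a::euclidean_space \<Rightarrow> 'b::euclidean_space \<Rightarrow> 'c::euclidean_space"
  assumes "bounded_bilinear h" "continuous_on {a..b::real} x" "f absolutely_integrable_on {a..b}"
  shows "(\<lambda>s. h (x s) (f s)) absolutely_integrable_on {a..b}"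
proof (rule absolutely_integrable_bounded_measurable_product[where h=h])
  show "bilinear h" using assms(1) by (simp add: bilinear_conv_bounded_bilinear)
  show "x \<in> borel_measurable (lebesgue_on {a..b})"
    using assms(2) by (intro continuous_imp_measurable_on_sets_lebesgue) auto
  show "bounded (x ` {a..b})"
    using assms(2) by (intro compact_imp_bounded compact_continuous_image) auto
qed (use assms in auto)

lemmas absolutely_integrable_continuous_inner =
  absolutely_integrable_continuous_product[OF bounded_bilinear_inner]

text \<open>Flipped, so that the vector is the continuous factor and the scalar the merely
  integrable one.\<close>

lemmas absolutely_integrable_continuous_scaleR =
  absolutely_integrable_continuous_product[OF bounded_bilinear.flip[OF bounded_bilinear_scaleR]]

text \<open>The step length \<open>d\<close> does not depend on the position, so \<open>n\<close>
  steps reach \<open>n * d\<close>, and finitely many of them exhaust the interval.\<close>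

lemma small_steps_induct:
  fixes P :: "real \<Rightarrow> bool"
  assumes "P 0" "d > 0"
    and step: "\<And>s t. 0 \<le> s \<Longrightarrow> s \<le> t \<Longrightarrow> t \<le> T \<Longrightarrow> t \<le> s + d \<Longrightarrow> P s \<Longrightarrow> P t"
    and "0 \<le> t" "t \<le> T"
  shows "P t"
proof -
  have "\<forall>t. 0 \<le> t \<and> t \<le> real n * d \<and> t \<le> T \<longrightarrow> P t" for n
  proof (induction n)
    case 0
    then show ?case using \<open>P 0\<close> by (auto dest: order_antisym)
  next
    case (Suc n)
    show ?case
    proof (intro allI impI)
      fix t assume t: "0 \<le> t \<and> t \<le> real (Suc n) * d \<and> t \<le> T"
      let ?s = "min t (real n * d)"
      have "0 \<le> ?s" "P ?s" using Suc t \<open>d > 0\<close> by auto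
      then show "P t" using t \<open>d > 0\<close> by (intro step[of ?s t]) (auto simp: algebra_simps min_def)
    qed
  qed
  moreover obtain n :: nat where "t / d < n"
    using reals_Archimedean2 by blast
  then have "t \<le> real n * d" using \<open>d > 0\<close> by (simp add: field_simps)
  ultimately show ?thesis using assms by blast
qed

lemma integral_diff_eq:
  fixes f :: "real \<Rightarrow> 'a::euclidean_space"
  assumes "f integrable_on {0..T}" "0 \<le> s" "s \<le> t" "t \<le> T"
  shows "integral {0..t} f - integral {0..s} f = integral {s..t} f"
  using Henstock_Kurzweil_Integration.integral_combine[of 0 s t f] assms
    integrable_on_subinterval[OF assms(1), of 0 t] by (simp add: algebra_simps)

lemma norm_integral_le:
  fixes f :: "real \<Rightarrow> 'a::euclidean_space"
  assumes "f absolutely_integrable_on S" "g integrable_on S" "\<And>t. t \<in> S \<Longrightarrow> norm (f t) \<le> g t"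
  shows "norm (integral S f) \<le> integral S g"
  using assms by (intro integral_norm_bound_integral) (auto simp: absolutely_integrable_on_def)

text \<open>By uniform continuity of \<open>x\<close>, the defect between the two sides is at most \<open>e * \<integral>norm f\<close> for
  every \<open>e > 0\<close>; no almost everywhere differentiability is involved.\<close>

lemma norm_square_integral:
  fixes x f :: "real \<Rightarrow> 'a::euclidean_space"
  assumes T: "0 \<le> T" and x: "continuous_on {0..T} x" and f: "f absolutely_integrable_on {0..T}"
    and eq: "\<And>t. t \<in> {0..T} \<Longrightarrow> x t = x0 + integral {0..t} f"
    and t: "t \<in> {0..T}"
  shows "(norm (x t))\<^sup>2 = (norm x0)\<^sup>2 + integral {0..t} (\<lambda>s. 2 * inner (x s) (f s))"
proof -
  let ?g = "\<lambda>s. 2 * inner (x s) (f s)"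
  let ?h = "\<lambda>s. norm (f s)"
  have g: "?g absolutely_integrable_on {0..T}"
    using absolutely_integrable_continuous_inner[OF x f] by (rule set_integrable_mult_right)
  then have gi: "?g integrable_on {0..T}" by (simp add: absolutely_integrable_on_def)
  have hi: "?h integrable_on {0..T}" and fi: "f integrable_on {0..T}"
    using f by (auto simp: absolutely_integrable_on_def)
  define D where "D t = (norm (x t))\<^sup>2 - (norm x0)\<^sup>2 - integral {0..t} ?g" for t
  have D_le: "\<bar>D t\<bar> \<le> e * integral {0..t} ?h" if "e > 0" for e
  proof -
    have "uniformly_continuous_on {0..T} x"
      using x by (intro compact_uniformly_continuous) auto
    then obtain d where "d > 0" and d: "\<And>s r. s \<in> {0..T} \<Longrightarrow> r \<in> {0..T} \<Longrightarrow> dist s r < d \<Longrightarrow> dist (x s) (x r) < e/2"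
      using \<open>e > 0\<close> unfolding uniformly_continuous_on_def by (metis half_gt_zero)
    show ?thesis
    \<comment> \<open>The right-hand side is additive over adjacent intervals, so local estimates of
      the defect add up without loss. Halving \<open>d\<close> turns the closed step condition into
      the strict one of uniform continuity.\<close>
    proof (rule small_steps_induct[where P="\<lambda>t. \<bar>D t\<bar> \<le> e * integral {0..t} ?h" and d="d/2" and T=T])
      show "\<bar>D 0\<bar> \<le> e * integral {0..0} ?h"
        using eq[of 0] T by (simp add: D_def)
    next
      fix s t assume st: "0 \<le> s" "s \<le> t" "t \<le> T" "t \<le> s + d/2" and IH: "\<bar>D s\<bar> \<le> e * integral {0..s} ?h"
      have sub: "{s..t} \<subseteq> {0..T}" using st by auto
      have fst: "f absolutely_integrable_on {s..t}" "?g absolutely_integrable_on {s..t}" "?h integrable_on {s..t}"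
        using absolutely_integrable_on_subinterval[OF f sub] absolutely_integrable_on_subinterval[OF g sub]
          integrable_on_subinterval[OF hi sub] by auto
      have fi': "f integrable_on {s..t}" "?g integrable_on {s..t}"
        using fst by (auto simp: absolutely_integrable_on_def)
      have xd: "x t - x s = integral {s..t} f"
        using eq[of s] eq[of t] st integral_diff_eq[OF fi, of s t] by simp
      \<comment> \<open>This factorization replaces the product rule: on a short step both
        \<open>x t\<close> and \<open>x s\<close> are within \<open>e/2\<close> of
        \<open>x r\<close>, so their sum differs from \<open>2 * x r\<close> by at most
        \<open>e\<close>.\<close>
      have sq: "(norm (x t))\<^sup>2 - (norm (x s))\<^sup>2 = inner (x t + x s) (x t - x s)"
        by (simp add: power2_norm_eq_inner algebra_simps inner_commute)
      have lin: "inner (x t + x s) (integral {s..t} f) = integral {s..t} (\<lambda>r. inner (x t + x s) (f r))"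
        using integral_linear[OF fi'(1) bounded_linear_inner_right[of "x t + x s"]] by (simp add: o_def)
      have int1: "(\<lambda>r. inner (x t + x s) (f r)) absolutely_integrable_on {s..t}"
        using fst(1) by (intro absolutely_integrable_continuous_inner) auto
      have "D t - D s = ((norm (x t))\<^sup>2 - (norm (x s))\<^sup>2) - integral {s..t} ?g"
        using integral_diff_eq[OF gi, of s t] st unfolding D_def by linarith
      also have "\<dots> = integral {s..t} (\<lambda>r. inner (x t + x s) (f r)) - integral {s..t} ?g"
        by (simp only: sq xd lin)
      also have "\<dots> = integral {s..t} (\<lambda>r. inner (x t + x s) (f r) - ?g r)"
        using int1 fi' by (intro Henstock_Kurzweil_Integration.integral_diff[symmetric]) (auto simp: absolutely_integrable_on_def)
      finally have Dd: "D t - D s = integral {s..t} (\<lambda>r. inner (x t + x s) (f r) - ?g r)" .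
      have "norm (D t - D s) \<le> integral {s..t} (\<lambda>r. e * ?h r)"
        unfolding Dd
      proof (rule norm_integral_le)
        show "(\<lambda>r. inner (x t + x s) (f r) - ?g r) absolutely_integrable_on {s..t}"
          using int1 fst by (intro set_integral_diff)
        show "(\<lambda>r. e * ?h r) integrable_on {s..t}" using fst by (intro integrable_on_mult_right)
        fix r assume r: "r \<in> {s..t}"
        have "dist (x t) (x r) < e/2" "dist (x s) (x r) < e/2"
          using r st \<open>d > 0\<close> d[of t r] d[of s r] by (auto simp: dist_real_def)
        then have "norm ((x t - x r) + (x s - x r)) \<le> e"
          using norm_triangle_ineq[of "x t - x r" "x s - x r"] by (simp add: dist_norm)
        moreover have "inner (x t + x s) (f r) - ?g r = inner ((x t - x r) + (x s - x r)) (f r)"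
          by (simp add: inner_diff_left inner_add_left)
        ultimately show "norm (inner (x t + x s) (f r) - ?g r) \<le> e * ?h r"
          using Cauchy_Schwarz_ineq2[of "(x t - x r) + (x s - x r)" "f r"]
          by (simp, meson mult_right_mono norm_ge_zero order_trans)
      qed
      also have "\<dots> = e * integral {s..t} ?h" by simp
      also have "\<dots> = e * integral {0..t} ?h - e * integral {0..s} ?h"
        using integral_diff_eq[OF hi, of s t] st by (simp flip: right_diff_distrib)
      finally show "\<bar>D t\<bar> \<le> e * integral {0..t} ?h" using IH by simp
    qed (use t \<open>d > 0\<close> in auto)
  qed
  moreover have "integral {0..t} ?h \<ge> 0"
    by (intro Henstock_Kurzweil_Integration.integral_nonneg integrable_on_subinterval[OF hi]) (use t in auto)
  ultimately have "\<bar>D t\<bar> \<le> 0 + e" if "e > 0" for e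
  proof -
    \<comment> \<open>The added 1 covers the case of a vanishing integral.\<close>
    let ?C = "integral {0..t} ?h + 1"
    have C: "?C > 0" using \<open>integral {0..t} ?h \<ge> 0\<close> by simp
    have "\<bar>D t\<bar> \<le> e / ?C * integral {0..t} ?h"
      using that C by (intro D_le divide_pos_pos)
    also have "\<dots> \<le> e" using that C by (simp add: field_simps)
    finally show ?thesis by simp
  qed
  then have "\<bar>D t\<bar> \<le> 0" by (rule field_le_epsilon)
  then show ?thesis by (simp add: D_def)
qed

text \<open>Gronwall's uniqueness by steps so short that the integral of \<open>norm (c s)\<close>
  is at most 1/2: starting from 0, the maximum of \<open>\<bar>v\<bar>\<close> over such a step is
  at most half of itself.\<close>

lemma linear_integral_equation_zero:
  fixes v c :: "real \<Rightarrow> real"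
  assumes T: "0 \<le> T" and v: "continuous_on {0..T} v" and c: "c absolutely_integrable_on {0..T}"
    and eq: "\<And>t. t \<in> {0..T} \<Longrightarrow> v t = integral {0..t} (\<lambda>s. c s * v s)"
    and t: "t \<in> {0..T}"
  shows "v t = 0"
proof -
  let ?h = "\<lambda>s. norm (c s)"
  have hi: "?h integrable_on {0..T}" using c by (simp add: absolutely_integrable_on_def)
  have cv: "(\<lambda>s. c s * v s) absolutely_integrable_on {0..T}"
    using absolutely_integrable_continuous_scaleR[OF v c] by simp
  then have cvi: "(\<lambda>s. c s * v s) integrable_on {0..T}" by (simp add: absolutely_integrable_on_def)
  \<comment> \<open>\<open>c\<close> may be unbounded, so the uniform step length comes from
    continuity of its indefinite integral.\<close>
  have "uniformly_continuous_on {0..T} (\<lambda>t. integral {0..t} ?h)"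
    using hi by (intro compact_uniformly_continuous indefinite_integral_continuous_1) auto
  then obtain d where "d > 0"
    and d: "\<And>s r. s \<in> {0..T} \<Longrightarrow> r \<in> {0..T} \<Longrightarrow> dist s r < d \<Longrightarrow> dist (integral {0..s} ?h) (integral {0..r} ?h) < 1/2"
    unfolding uniformly_continuous_on_def by (metis half_gt_zero zero_less_one)
  have "v t = 0"
  proof (rule small_steps_induct[where P="\<lambda>t. v t = 0" and d="d/2" and T=T])
    show "v 0 = 0" using eq[of 0] T by simp
  next
    fix s t assume st: "0 \<le> s" "s \<le> t" "t \<le> T" "t \<le> s + d/2" and IH: "v s = 0"
    have sub: "{s..t} \<subseteq> {0..T}" using st by auto
    obtain r where r: "r \<in> {s..t}" and max: "\<And>q. q \<in> {s..t} \<Longrightarrow> \<bar>v q\<bar> \<le> \<bar>v r\<bar>"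
      using continuous_attains_sup[OF compact_Icc _ continuous_on_rabs[OF continuous_on_subset[OF v sub]]] st
      by (metis atLeastAtMost_iff empty_iff order_refl)
    have subr: "{s..r} \<subseteq> {0..T}" using r sub by auto
    have his: "?h integrable_on {s..r}" by (rule integrable_on_subinterval[OF hi subr])
    have "v r = v r - v s" using IH by simp
    also have "\<dots> = integral {s..r} (\<lambda>q. c q * v q)"
      using eq[of r] eq[of s] integral_diff_eq[OF cvi, of s r] r st by simp
    finally have "\<bar>v r\<bar> \<le> norm (integral {s..r} (\<lambda>q. c q * v q))" by simp
    also have "\<dots> \<le> integral {s..r} (\<lambda>q. ?h q * \<bar>v r\<bar>)"
    proof (rule norm_integral_le)
      show "(\<lambda>q. c q * v q) absolutely_integrable_on {s..r}"
        by (rule absolutely_integrable_on_subinterval[OF cv subr])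
      show "(\<lambda>q. ?h q * \<bar>v r\<bar>) integrable_on {s..r}" using his by (intro integrable_on_mult_left)
      show "norm (c q * v q) \<le> ?h q * \<bar>v r\<bar>" if "q \<in> {s..r}" for q
        using max[of q] that r by (auto simp: abs_mult intro!: mult_left_mono)
    qed
    also have "\<dots> = integral {s..r} ?h * \<bar>v r\<bar>" by simp
    also have "\<dots> \<le> 1/2 * \<bar>v r\<bar>"
    proof (rule mult_right_mono)
      have "integral {s..r} ?h = integral {0..r} ?h - integral {0..s} ?h"
        using integral_diff_eq[OF hi, of s r] r st by simp
      also have "\<dots> \<le> dist (integral {0..r} ?h) (integral {0..s} ?h)"
        unfolding dist_real_def by (rule abs_ge_self)
      also have "\<dots> \<le> 1/2"
        using r st \<open>d > 0\<close> by (intro less_imp_le d) (auto simp: dist_real_def)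
      finally show "integral {s..r} ?h \<le> 1/2" .
    qed simp
    finally have "v r = 0" by simp
    then show "v t = 0" using max[of t] st by simp
  qed (use t \<open>d > 0\<close> in auto)
  then show ?thesis .
qed

section \<open>The controlled system\<close>

text \<open>Subsequences are refined one index at a time; the limits already found survive each
  refinement.\<close>

lemma Arzela_Ascoli_family:
  fixes F :: "nat \<Rightarrow> nat \<Rightarrow> 'a::euclidean_space \<Rightarrow> 'b::euclidean_space"
  assumes "compact S"
    and bound: "\<And>n i x. i < N \<Longrightarrow> x \<in> S \<Longrightarrow> norm (F n i x) \<le> B"
    and equicont: "\<And>i x e. i < N \<Longrightarrow> x \<in> S \<Longrightarrow> 0 < e \<Longrightarrow>
      \<exists>d>0. \<forall>n y. y \<in> S \<and> norm (x - y) < d \<longrightarrow> norm (F n i x - F n i y) < e"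
  obtains G r where "strict_mono (r :: nat \<Rightarrow> nat)" "\<And>i. i < N \<Longrightarrow> continuous_on S (G i)"
    "\<And>i. i < N \<Longrightarrow> uniform_limit S (\<lambda>n. F (r n) i) (G i) sequentially"
proof -
  have "\<exists>G r. strict_mono (r :: nat \<Rightarrow> nat) \<and> (\<forall>i<m. continuous_on S (G i) \<and>
      uniform_limit S (\<lambda>n. F (r n) i) (G i) sequentially)" if "m \<le> N" for m
    using that
  proof (induction m)
    case 0
    have "strict_mono (id :: nat \<Rightarrow> nat)" by (simp add: strict_mono_def)
    then show ?case by blast
  next
    case (Suc m)
    then obtain G r where r: "strict_mono (r :: nat \<Rightarrow> nat)"
      and G: "\<And>i. i < m \<Longrightarrow> continuous_on S (G i)"
        "\<And>i. i < m \<Longrightarrow> uniform_limit S (\<lambda>n. F (r n) i) (G i) sequentially"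
      by auto
    have m: "m < N" using Suc by simp
    obtain g k where g: "continuous_on S g" and k: "strict_mono (k :: nat \<Rightarrow> nat)"
      and lim: "\<And>e. 0 < e \<Longrightarrow> \<exists>K. \<forall>n x. n \<ge> K \<and> x \<in> S \<longrightarrow> norm (F (r (k n)) m x - g x) < e"
    proof (rule Arzela_Ascoli[OF \<open>compact S\<close>, of "\<lambda>n. F (r n) m" B])
      show "norm (F (r n) m x) \<le> B" if "x \<in> S" for n x
        using bound m that by blast
      show "\<exists>d>0. \<forall>n y. y \<in> S \<and> norm (x - y) < d \<longrightarrow> norm (F (r n) m x - F (r n) m y) < e"
        if "x \<in> S" "0 < e" for x e
        using equicont[OF m that] by blast
    qed (rule that)
    have "uniform_limit S (\<lambda>n. F (r (k n)) m) g sequentially"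
      using lim unfolding uniform_limit_sequentially_iff dist_norm by blast
    moreover have "uniform_limit S (\<lambda>n. F (r (k n)) i) (G i) sequentially" if "i < m" for i
      using G(2)[OF that] filterlim_subseq[OF k] by (rule filterlim_compose)
    ultimately have "\<forall>i<Suc m. continuous_on S ((G(m := g)) i) \<and>
        uniform_limit S (\<lambda>n. F ((r \<circ> k) n) i) ((G(m := g)) i) sequentially"
      using G(1) g by (auto simp: less_Suc_eq)
    then show ?case using strict_mono_o[OF r k] by blast
  qed
  from this[OF order_refl] that show ?thesis by blast
qed

text \<open>The part of \<open>rhs\<close> that is free of the control. It converges with the
  trajectories by domination; the rest is linear in the control once the trajectory is
  fixed.\<close>

definition coupling :: "real \<Rightarrow> nat \<Rightarrow> (nat \<Rightarrow> real \<Rightarrow> 'a::euclidean_space) \<Rightarrow> nat \<Rightarrow> real \<Rightarrow> 'a" where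
  "coupling \<kappa> N x i s = (\<kappa> / real N) *\<^sub>R (\<Sum>k<N. x k s - inner (x i s) (x k s) *\<^sub>R x i s)"

section \<open>Bounds for the vector field on the sphere\<close>

lemma rhs_eq: "rhs \<kappa> N u x i s = coupling \<kappa> N x i s + (u i s - inner (u i s) (x i s) *\<^sub>R x i s)"
  by (simp add: rhs_def coupling_def)

lemma coupling_continuous:
  assumes "\<And>k. k < N \<Longrightarrow> continuous_on S (x k)" "i < N"
  shows "continuous_on S (coupling \<kappa> N x i)"
  unfolding coupling_def using assms by (auto intro!: continuous_intros)

text \<open>The vector on the left is an orthogonal projection of \<open>u\<close>, so 1 would do as
  factor; the triangle inequality gives 2, which is enough for every later estimate.\<close>

lemma norm_tangent_le:
  fixes y u :: "'a::real_inner"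
  assumes "norm y = 1"
  shows "norm (u - inner u y *\<^sub>R y) \<le> 2 * norm u"
proof -
  have "norm (u - inner u y *\<^sub>R y) \<le> norm u + \<bar>inner u y\<bar>"
    using norm_triangle_ineq4[of u "inner u y *\<^sub>R y"] assms by simp
  also have "\<dots> \<le> 2 * norm u"
    using Cauchy_Schwarz_ineq2[of u y] assms by simp
  finally show ?thesis .
qed

lemma norm_coupling_le:
  assumes "\<And>k. k < N \<Longrightarrow> norm (x k s) = 1" "i < N" "\<kappa> \<ge> 0"
  shows "norm (coupling \<kappa> N x i s) \<le> 2 * \<kappa>"
proof -
  have "norm (\<Sum>k<N. x k s - inner (x i s) (x k s) *\<^sub>R x i s) \<le> (\<Sum>k<N. 2)"
  proof (rule sum_norm_le)
    fix k assume "k \<in> {..<N}"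
    then show "norm (x k s - inner (x i s) (x k s) *\<^sub>R x i s) \<le> 2"
      using norm_tangent_le[of "x i s" "x k s"] assms by (simp add: inner_commute)
  qed
  then have "norm (coupling \<kappa> N x i s) \<le> \<kappa> / N * (2 * N)"
    unfolding coupling_def norm_scaleR using assms by (intro mult_mono) auto
  then show ?thesis using assms by simp
qed

lemma tangent_absolutely_integrable:
  fixes y u :: "real \<Rightarrow> 'a::euclidean_space"
  assumes y: "continuous_on {a..b} y" and u: "u absolutely_integrable_on {a..b}"
  shows "(\<lambda>s. u s - inner (u s) (y s) *\<^sub>R y s) absolutely_integrable_on {a..b}"
proof -
  have "(\<lambda>s. inner (u s) (y s)) absolutely_integrable_on {a..b}"
    using absolutely_integrable_continuous_inner[OF y u] by (simp add: inner_commute)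
  from absolutely_integrable_continuous_scaleR[OF y this] u show ?thesis
    by (intro set_integral_diff)
qed

section \<open>Trajectories of square integrable controls\<close>

lemma finite_measure_Icc: "finite_measure (lebesgue_on {a..b::real})"
  by (rule finite_measure_lebesgue_on) simp

lemma L2_on_iff: "L2_on T f \<longleftrightarrow> square_integrable (lebesgue_on {0..T}) f"
  by (simp add: L2_on_def square_integrable_def)

lemma integrable_lebesgue_on_iff:
  "integrable (lebesgue_on {a..b::real}) f \<longleftrightarrow> f absolutely_integrable_on {a..b}"
  by (simp add: integrable_restrict_space set_integrable_def)

lemma L2_on_absolutely_integrable:
  assumes "L2_on T u" shows "u absolutely_integrable_on {0..T}"
  using finite_measure.square_integrable_imp_integrable[OF finite_measure_Icc] assms
  by (simp add: L2_on_iff flip: integrable_lebesgue_on_iff)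

lemma is_solution_integral_iff:
  "is_solution \<kappa> N T x0 u x \<longleftrightarrow> (\<forall>i<N. continuous_on {0..T} (x i) \<and> x i 0 = x0 i \<and>
     (\<forall>t\<in>{0..T}. rhs \<kappa> N u x i absolutely_integrable_on {0..t} \<and>
        x i t = x0 i + integral {0..t} (rhs \<kappa> N u x i)))"
  unfolding is_solution_def by (auto simp: set_lebesgue_integral_eq_integral)

lemma is_solution_sphere:
  assumes sol: "is_solution \<kappa> N T x0 u x" and T: "T \<ge> 0" and u: "\<forall>i<N. L2_on T (u i)"
    and x0: "\<forall>i<N. norm (x0 i) = 1" and i: "i < N" and t: "t \<in> {0..T}"
  shows "norm (x i t) = 1"
proof -
  have cont: "\<And>k. k < N \<Longrightarrow> continuous_on {0..T} (x k)"
    and f: "rhs \<kappa> N u x i absolutely_integrable_on {0..T}"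
    and eq: "\<And>t. t \<in> {0..T} \<Longrightarrow> x i t = x0 i + integral {0..t} (rhs \<kappa> N u x i)"
    using sol i T by (auto simp: is_solution_integral_iff)
  \<comment> \<open>The coupling is the same expression \<open>a - inner a x *\<^sub>R x\<close>
    with the scaled sum of the points as \<open>a\<close>, so coupling and control merge into a
    single driving vector.\<close>
  define a where "a s = (\<kappa> / real N) *\<^sub>R (\<Sum>k<N. x k s) + u i s" for s
  have rhs: "rhs \<kappa> N u x i s = a s - inner (a s) (x i s) *\<^sub>R x i s" for s
    by (simp add: rhs_def a_def sum_subtractf inner_add_left inner_sum_left inner_sum_right algebra_simps
        inner_commute flip: scaleR_sum_left)
  have "(\<lambda>s. (\<kappa> / real N) *\<^sub>R (\<Sum>k<N. x k s)) absolutely_integrable_on {0..T}"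
    using cont by (intro absolutely_integrable_continuous_real continuous_intros) auto
  then have a: "a absolutely_integrable_on {0..T}"
    unfolding a_def using L2_on_absolutely_integrable u i by (intro set_integral_add) auto
  \<comment> \<open>Formally the derivative of \<open>(norm x)\<^sup>2\<close> is
    \<open>2 * inner x a * (1 - (norm x)\<^sup>2)\<close>, which gives this coefficient for
    \<open>(norm x)\<^sup>2 - 1\<close>.\<close>
  define c where "c s = - 2 * inner (x i s) (a s)" for s
  have c: "c absolutely_integrable_on {0..T}"
    unfolding c_def using absolutely_integrable_continuous_inner[OF cont[OF i] a]
    by (intro set_integrable_mult_right)
  have "(norm (x i t))\<^sup>2 - 1 = 0"
  proof (rule linear_integral_equation_zero[OF T _ c _ t])
    show "continuous_on {0..T} (\<lambda>t. (norm (x i t))\<^sup>2 - 1)"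
      using cont[OF i] by (intro continuous_intros)
    fix t assume "t \<in> {0..T}"
    then have "(norm (x i t))\<^sup>2 = 1 + integral {0..t} (\<lambda>s. 2 * inner (x i s) (rhs \<kappa> N u x i s))"
      using norm_square_integral[OF T cont[OF i] f eq] x0 i by simp
    also have "(\<lambda>s. 2 * inner (x i s) (rhs \<kappa> N u x i s)) = (\<lambda>s. c s * ((norm (x i s))\<^sup>2 - 1))"
      unfolding rhs c_def by (simp add: power2_norm_eq_inner algebra_simps inner_commute)
    finally show "(norm (x i t))\<^sup>2 - 1 = integral {0..t} (\<lambda>s. c s * ((norm (x i s))\<^sup>2 - 1))" by simp
  qed
  then show ?thesis
    using norm_ge_zero[of "x i t"] by (auto simp: power2_eq_1_iff)
qed

text \<open>Equicontinuity with a free weight \<open>\<eta>\<close>: first \<open>\<eta>\<close>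
  makes the energy term small, uniformly over controls of bounded energy, then a short time interval
  makes the other term small.\<close>

lemma is_solution_increment:
  assumes sol: "is_solution \<kappa> N T x0 u x" and u: "\<forall>i<N. L2_on T (u i)"
    and sphere: "\<And>k s. k < N \<Longrightarrow> s \<in> {0..T} \<Longrightarrow> norm (x k s) = 1"
    and "\<kappa> \<ge> 0" "i < N" "0 \<le> s" "s \<le> t" "t \<le> T" "\<eta> > 0"
  shows "norm (x i t - x i s) \<le> (2 * \<kappa> + 1 / \<eta>) * (t - s) + \<eta> * energy (lebesgue_on {0..T}) {..<N} u"
proof -
  have f: "rhs \<kappa> N u x i absolutely_integrable_on {0..T}"
    and eq: "\<And>t. t \<in> {0..T} \<Longrightarrow> x i t = x0 i + integral {0..t} (rhs \<kappa> N u x i)"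
    using sol assms by (auto simp: is_solution_integral_iff)
  have sub: "{s..t} \<subseteq> {0..T}" using assms by auto
  have u2: "(\<lambda>s. (norm (u i s))\<^sup>2) absolutely_integrable_on {0..T}"
    using u \<open>i < N\<close> by (simp add: L2_on_def flip: integrable_lebesgue_on_iff)
  then have u2i: "(\<lambda>s. (norm (u i s))\<^sup>2) integrable_on {0..T}"
    by (simp add: absolutely_integrable_on_def)
  have u2s: "(\<lambda>s. (norm (u i s))\<^sup>2) integrable_on {s..t}"
    by (rule integrable_on_subinterval[OF u2i sub])
  have "x i t - x i s = integral {s..t} (rhs \<kappa> N u x i)"
    using eq[of s] eq[of t] assms integral_diff_eq[of "rhs \<kappa> N u x i" T s t] f
    by (simp add: absolutely_integrable_on_def)
  also have "norm \<dots> \<le> integral {s..t} (\<lambda>r. (2 * \<kappa> + 1 / \<eta>) + \<eta> * (norm (u i r))\<^sup>2)"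
  proof (rule norm_integral_le)
    show "rhs \<kappa> N u x i absolutely_integrable_on {s..t}"
      by (rule absolutely_integrable_on_subinterval[OF f sub])
    show "(\<lambda>r. (2 * \<kappa> + 1 / \<eta>) + \<eta> * (norm (u i r))\<^sup>2) integrable_on {s..t}"
      using u2s by (intro integrable_add integrable_on_mult_right) auto
    fix r assume "r \<in> {s..t}"
    then have r: "r \<in> {0..T}" using sub by auto
    have "norm (rhs \<kappa> N u x i r) \<le> 2 * \<kappa> + 2 * norm (u i r)"
      unfolding rhs_eq using norm_coupling_le[of N x r i \<kappa>] norm_tangent_le[of "x i r" "u i r"] sphere r assms
      by (intro norm_triangle_le add_mono) auto
    moreover have "2 * norm (u i r) \<le> 1 / \<eta> + \<eta> * (norm (u i r))\<^sup>2"
      using zero_le_power2[of "\<eta> * norm (u i r) - 1"] \<open>\<eta> > 0\<close>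
      by (simp add: power2_eq_square field_simps)
    ultimately show "norm (rhs \<kappa> N u x i r) \<le> (2 * \<kappa> + 1 / \<eta>) + \<eta> * (norm (u i r))\<^sup>2" by linarith
  qed
  also have "\<dots> = (2 * \<kappa> + 1 / \<eta>) * (t - s) + \<eta> * integral {s..t} (\<lambda>r. (norm (u i r))\<^sup>2)"
    using u2s \<open>s \<le> t\<close> by (subst Henstock_Kurzweil_Integration.integral_add) (auto intro: integrable_on_mult_right)
  also have "\<dots> \<le> (2 * \<kappa> + 1 / \<eta>) * (t - s) + \<eta> * energy (lebesgue_on {0..T}) {..<N} u"
  proof -
    have "integral {s..t} (\<lambda>r. (norm (u i r))\<^sup>2) \<le> integral {0..T} (\<lambda>r. (norm (u i r))\<^sup>2)"
      by (rule integral_subset_le[OF sub u2s u2i]) simp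
    also have "\<dots> = (\<integral>r. (norm (u i r))\<^sup>2 \<partial>lebesgue_on {0..T})"
      using u2 by (intro lebesgue_integral_eq_integral[symmetric]) (auto simp: integrable_lebesgue_on_iff)
    also have "\<dots> \<le> energy (lebesgue_on {0..T}) {..<N} u"
      using \<open>i < N\<close> by (intro energy_component_le) auto
    finally show ?thesis using \<open>\<eta> > 0\<close> by simp
  qed
  finally show ?thesis .
qed

section \<open>Splitting the cost into dispersion and energy\<close>

definition dispersion :: "nat \<Rightarrow> real \<Rightarrow> (nat \<Rightarrow> real \<Rightarrow> 'a::euclidean_space) \<Rightarrow> real" where
  "dispersion N T x = integral {0..T} (\<lambda>t. (1 / real N) *
     (\<Sum>i<N. (norm (x i t - (1 / real N) *\<^sub>R (\<Sum>j<N. x j t)))\<^sup>2))"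

text \<open>Separates what depends on the trajectory alone from what depends on the control alone;
  the two parts pass to the limit by different means.\<close>

lemma cost_eq:
  assumes u: "\<forall>i<N. L2_on T (u i)" and x: "\<And>i. i < N \<Longrightarrow> continuous_on {0..T} (x i)"
  shows "cost N T lam u x = dispersion N T x + lam / N * energy (lebesgue_on {0..T}) {..<N} u"
proof -
  let ?D = "\<lambda>t. (1 / real N) * (\<Sum>i<N. (norm (x i t - (1 / real N) *\<^sub>R (\<Sum>j<N. x j t)))\<^sup>2)"
  let ?U = "\<lambda>t. \<Sum>i<N. (norm (u i t))\<^sup>2"
  have D: "?D absolutely_integrable_on {0..T}"
    using x by (intro absolutely_integrable_continuous_real continuous_intros) auto
  have Ui: "integrable (lebesgue_on {0..T}) (\<lambda>t. (norm (u i t))\<^sup>2)" if "i < N" for i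
    using u that by (auto simp: L2_on_def)
  then have "integrable (lebesgue_on {0..T}) ?U"
    by (intro Bochner_Integration.integrable_sum) auto
  then have U: "?U absolutely_integrable_on {0..T}"
    by (simp add: integrable_lebesgue_on_iff)
  have "cost N T lam u x = (LINT t:{0..T}|lebesgue. ?D t + lam / N * ?U t)"
    unfolding cost_def by (simp add: sum.distrib algebra_simps flip: sum_distrib_left)
  also have "\<dots> = (LINT t:{0..T}|lebesgue. ?D t) + lam / N * (LINT t:{0..T}|lebesgue. ?U t)"
    using D U by simp
  also have "(LINT t:{0..T}|lebesgue. ?D t) = dispersion N T x"
    unfolding dispersion_def by (rule set_lebesgue_integral_eq_integral(2)[OF D])
  also have "(LINT t:{0..T}|lebesgue. ?U t) = energy (lebesgue_on {0..T}) {..<N} u"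
  proof -
    have "(LINT t:{0..T}|lebesgue. ?U t) = (\<integral>t. ?U t \<partial>lebesgue_on {0..T})"
      unfolding set_lebesgue_integral_def by (subst integral_restrict_space) auto
    also have "\<dots> = energy (lebesgue_on {0..T}) {..<N} u"
      unfolding energy_def using Ui by (intro Bochner_Integration.integral_sum) auto
    finally show ?thesis .
  qed
  finally show ?thesis .
qed

lemma dispersion_nonneg: "dispersion N T x \<ge> 0"
proof (cases "(\<lambda>t. (1 / real N) * (\<Sum>i<N. (norm (x i t - (1 / real N) *\<^sub>R (\<Sum>j<N. x j t)))\<^sup>2)) integrable_on {0..T}")
  case True
  then show ?thesis unfolding dispersion_def
    by (rule Henstock_Kurzweil_Integration.integral_nonneg) (simp add: sum_nonneg)
next
  case False
  \<comment> \<open>The integral of a non-integrable function is 0 by convention.\<close>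
  then show ?thesis unfolding dispersion_def by (simp only: not_integrable_integral[OF False] order_refl)
qed

lemma dispersion_tendsto:
  assumes cont: "\<And>n i. i < N \<Longrightarrow> continuous_on {0..T} (x n i)"
    and sphere: "\<And>n i t. i < N \<Longrightarrow> t \<in> {0..T} \<Longrightarrow> norm (x n i t) = 1"
    and conv: "\<And>i t. i < N \<Longrightarrow> t \<in> {0..T} \<Longrightarrow> (\<lambda>n. x n i t) \<longlonglongrightarrow> X i t"
  shows "(\<lambda>n. dispersion N T (x n)) \<longlonglongrightarrow> dispersion N T X"
  unfolding dispersion_def
proof (rule dominated_convergence(2))
  show "(\<lambda>t. (1 / real N) * (\<Sum>i<N. (norm (x n i t - (1 / real N) *\<^sub>R (\<Sum>j<N. x n j t)))\<^sup>2)) integrable_on {0..T}" for n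
    using cont by (intro integrable_continuous_real continuous_intros) auto
  \<comment> \<open>The points and their mean have norm at most 1, so each squared deviation is at
    most \<open>2\<^sup>2\<close>.\<close>
  show "(\<lambda>t. 4 :: real) integrable_on {0..T}" by auto
  show "norm ((1 / real N) * (\<Sum>i<N. (norm (x n i t - (1 / real N) *\<^sub>R (\<Sum>j<N. x n j t)))\<^sup>2)) \<le> 4"
    if "t \<in> {0..T}" for n t
  proof -
    have "norm (\<Sum>j<N. x n j t) \<le> (\<Sum>j<N. 1)"
      using sphere that by (intro sum_norm_le) auto
    then have m: "norm ((1 / real N) *\<^sub>R (\<Sum>j<N. x n j t)) \<le> 1"
      by (cases "N = 0") (auto simp: field_simps)
    have "(\<Sum>i<N. (norm (x n i t - (1 / real N) *\<^sub>R (\<Sum>j<N. x n j t)))\<^sup>2) \<le> (\<Sum>i<N. 4)"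
    proof (rule sum_mono)
      fix i assume "i \<in> {..<N}"
      then have "norm (x n i t - (1 / real N) *\<^sub>R (\<Sum>j<N. x n j t)) \<le> 2"
        using norm_triangle_le_diff[of "x n i t" "(1 / real N) *\<^sub>R (\<Sum>j<N. x n j t)" 2] sphere[of i t n] m that
        by fastforce
      then have "(norm (x n i t - (1 / real N) *\<^sub>R (\<Sum>j<N. x n j t)))\<^sup>2 \<le> 2\<^sup>2"
        by (intro power_mono) auto
      then show "(norm (x n i t - (1 / real N) *\<^sub>R (\<Sum>j<N. x n j t)))\<^sup>2 \<le> 4" by simp
    qed
    then have "(1 / real N) * (\<Sum>i<N. (norm (x n i t - (1 / real N) *\<^sub>R (\<Sum>j<N. x n j t)))\<^sup>2)
        \<le> (1 / real N) * (N * 4)"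
      by (intro mult_left_mono) auto
    also have "\<dots> \<le> 4" by simp
    finally show ?thesis
      by (simp only: real_norm_def abs_of_nonneg sum_nonneg zero_le_power2 mult_nonneg_nonneg
          zero_le_divide_iff zero_le_one of_nat_0_le_iff simp_thms)
  qed
  show "(\<lambda>n. (1 / real N) * (\<Sum>i<N. (norm (x n i t - (1 / real N) *\<^sub>R (\<Sum>j<N. x n j t)))\<^sup>2))
    \<longlonglongrightarrow> (1 / real N) * (\<Sum>i<N. (norm (X i t - (1 / real N) *\<^sub>R (\<Sum>j<N. X j t)))\<^sup>2)"
    if "t \<in> {0..T}" for t
    using conv that by (intro tendsto_intros) auto
qed

text \<open>The Lipschitz constant in the base point is proportional to \<open>norm u\<close>, so
  uniform closeness of trajectories together with an L1 bound on the controls suffices when one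
  trajectory is exchanged for another.\<close>

lemma norm_tangent_diff_le:
  fixes y z u :: "'a::real_inner"
  assumes "norm y = 1" "norm z = 1"
  shows "norm ((u - inner u y *\<^sub>R y) - (u - inner u z *\<^sub>R z)) \<le> 2 * norm (y - z) * norm u"
proof -
  have "(u - inner u y *\<^sub>R y) - (u - inner u z *\<^sub>R z) = inner u (z - y) *\<^sub>R z + inner u y *\<^sub>R (z - y)"
    by (simp add: algebra_simps)
  also have "norm \<dots> \<le> \<bar>inner u (z - y)\<bar> + \<bar>inner u y\<bar> * norm (z - y)"
    using norm_triangle_ineq[of "inner u (z - y) *\<^sub>R z" "inner u y *\<^sub>R (z - y)"] assms by simp
  also have "\<dots> \<le> norm u * norm (z - y) + norm u * norm (z - y)"
    using Cauchy_Schwarz_ineq2[of u "z - y"] Cauchy_Schwarz_ineq2[of u y] assms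
    by (intro add_mono mult_right_mono) auto
  also have "\<dots> = 2 * norm (y - z) * norm u" by (simp add: norm_minus_commute)
  finally show ?thesis .
qed

text \<open>The state equation is affine in the control, so its integrated form passes from the tail of
  \<open>u\<close> to midpoint combinations; the trajectory has to be frozen at its limit \<open>X\<close> first.\<close>

lemma is_solution_limit:
  assumes T: "0 \<le> T" and \<kappa>: "\<kappa> \<ge> 0"
    and sol: "\<And>n. is_solution \<kappa> N T x0 (u n) (x n)"
    and u: "\<And>n i. i < N \<Longrightarrow> L2_on T (u n i)"
    and bound: "\<And>n i. i < N \<Longrightarrow> (\<integral>t. norm (u n i t) \<partial>lebesgue_on {0..T}) \<le> B"
    and sphere: "\<And>n i t. i < N \<Longrightarrow> t \<in> {0..T} \<Longrightarrow> norm (x n i t) = 1"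
    and X: "\<And>i. i < N \<Longrightarrow> continuous_on {0..T} (X i)"
    and conv: "\<And>i. i < N \<Longrightarrow> uniform_limit {0..T} (\<lambda>n. x n i) (X i) sequentially"
    and v: "\<And>k. v k \<in> tail_midpoints u k"
    and w: "\<And>i. i < N \<Longrightarrow> L2_on T (w i)"
    and vw: "\<And>i. i < N \<Longrightarrow> (\<lambda>k. \<integral>t. norm (v k i t - w i t) \<partial>lebesgue_on {0..T}) \<longlonglongrightarrow> 0"
  shows "is_solution \<kappa> N T x0 w X"
  unfolding is_solution_integral_iff
proof (intro allI impI conjI ballI)
  fix i assume i: "i < N"
  show "continuous_on {0..T} (X i)" using X i .
  have x_cont: "continuous_on {0..T} (x n k)" and x_0: "x n k 0 = x0 k"
    and x_int: "t \<in> {0..T} \<Longrightarrow> rhs \<kappa> N (u n) (x n) k absolutely_integrable_on {0..t}"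
    and x_eq: "t \<in> {0..T} \<Longrightarrow> x n k t = x0 k + integral {0..t} (rhs \<kappa> N (u n) (x n) k)"
    if "k < N" for n k t
    using sol that by (auto simp: is_solution_integral_iff)
  have lim: "(\<lambda>n. x n k t) \<longlonglongrightarrow> X k t" if "k < N" "t \<in> {0..T}" for k t
    by (rule tendsto_uniform_limitI[OF conv[OF that(1)] that(2)])
  have X_sphere: "norm (X k t) = 1" if "k < N" "t \<in> {0..T}" for k t
  proof (rule LIMSEQ_unique)
    show "(\<lambda>n. norm (x n k t)) \<longlonglongrightarrow> norm (X k t)"
      using lim[OF that] by (rule tendsto_norm)
    show "(\<lambda>n. norm (x n k t)) \<longlonglongrightarrow> 1"
      using sphere[OF that] by simp
  qed
  show "X i 0 = x0 i"
  proof (rule LIMSEQ_unique)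
    show "(\<lambda>n. x n i 0) \<longlonglongrightarrow> X i 0" using lim i T by simp
    show "(\<lambda>n. x n i 0) \<longlonglongrightarrow> x0 i" using x_0 i by simp
  qed
  fix t assume t: "t \<in> {0..T}"
  then have sub: "{0..t} \<subseteq> {0..T}" by auto
  have abs_u: "f absolutely_integrable_on {0..T}" "f absolutely_integrable_on {0..t}" if "L2_on T f" for f :: "real \<Rightarrow> 'a"
    using L2_on_absolutely_integrable[OF that] absolutely_integrable_on_subinterval[OF _ sub] by auto
  have X_cont: "continuous_on {0..t} (X k)" if "k < N" for k
    using X[OF that] sub by (rule continuous_on_subset)
  have x_cont': "continuous_on {0..t} (x n k)" if "k < N" for n k
    using x_cont[OF that] sub by (rule continuous_on_subset)
  have norm_int_le: "integral {0..t} (\<lambda>s. norm (f s)) \<le> (\<integral>s. norm (f s) \<partial>lebesgue_on {0..T})"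
    if "f absolutely_integrable_on {0..T}" for f :: "real \<Rightarrow> 'a"
  proof -
    have n: "(\<lambda>s. norm (f s)) absolutely_integrable_on {0..T}"
      using set_integrable_norm[OF that] .
    then have "(\<lambda>s. norm (f s)) integrable_on {0..T}"
      by (simp add: absolutely_integrable_on_def)
    then have "integral {0..t} (\<lambda>s. norm (f s)) \<le> integral {0..T} (\<lambda>s. norm (f s))"
      by (intro integral_subset_le sub integrable_on_subinterval[OF _ sub]) auto
    with n show ?thesis
      by (simp add: lebesgue_integral_eq_integral integrable_lebesgue_on_iff)
  qed
  define P where "P y f s = f s - inner (f s) (y s) *\<^sub>R y s" for y f :: "real \<Rightarrow> 'a" and s
  \<comment> \<open>With \<open>X\<close> frozen, \<open>\<phi>\<close> is linear in the control,
    which is what \<open>tail_midpoints_tendsto\<close> requires.\<close>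
  define \<phi> where "\<phi> f = integral {0..t} (P (X i) (f i))" for f :: "nat \<Rightarrow> real \<Rightarrow> 'a"
  have P_int: "P y f absolutely_integrable_on {0..t}" if "continuous_on {0..t} y" "L2_on T f" for y f
    unfolding P_def using that abs_u by (intro tangent_absolutely_integrable)
  have coupl_int: "coupling \<kappa> N y i absolutely_integrable_on {0..t}"
    if "\<And>k. k < N \<Longrightarrow> continuous_on {0..t} (y k)" for y :: "nat \<Rightarrow> real \<Rightarrow> 'a"
    using that i by (intro absolutely_integrable_continuous_real coupling_continuous)
  \<comment> \<open>The value that the control integral must take at \<open>w\<close> for
    \<open>X\<close> to satisfy the equation at time \<open>t\<close>.\<close>
  define L where "L = X i t - x0 i - integral {0..t} (coupling \<kappa> N X i)"
  have x_eq': "integral {0..t} (P (x n i) (u n i)) = x n i t - x0 i - integral {0..t} (coupling \<kappa> N (x n) i)" for n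
  proof -
    have "rhs \<kappa> N (u n) (x n) i = (\<lambda>s. coupling \<kappa> N (x n) i s + P (x n i) (u n i) s)"
      by (simp add: fun_eq_iff rhs_eq P_def)
    then have "x n i t = x0 i + integral {0..t} (\<lambda>s. coupling \<kappa> N (x n) i s + P (x n i) (u n i) s)"
      using x_eq[OF i t] by simp
    also have "integral {0..t} (\<lambda>s. coupling \<kappa> N (x n) i s + P (x n i) (u n i) s)
        = integral {0..t} (coupling \<kappa> N (x n) i) + integral {0..t} (P (x n i) (u n i))"
      using coupl_int[OF x_cont'] P_int[OF x_cont'[OF i] u[OF i]]
      by (intro Henstock_Kurzweil_Integration.integral_add) (auto simp: absolutely_integrable_on_def)
    finally show ?thesis by simp
  qed
  have "(\<lambda>n. integral {0..t} (coupling \<kappa> N (x n) i)) \<longlonglongrightarrow> integral {0..t} (coupling \<kappa> N X i)"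
  proof (rule dominated_convergence(2))
    show "coupling \<kappa> N (x n) i integrable_on {0..t}" for n
      using coupl_int[OF x_cont'] by (simp add: absolutely_integrable_on_def)
    show "norm (coupling \<kappa> N (x n) i s) \<le> 2 * \<kappa>" if "s \<in> {0..t}" for n s
      using sphere that sub i \<kappa> by (intro norm_coupling_le) auto
    show "(\<lambda>n. coupling \<kappa> N (x n) i s) \<longlonglongrightarrow> coupling \<kappa> N X i s" if "s \<in> {0..t}" for s
      unfolding coupling_def using lim that sub i by (intro tendsto_intros) auto
  qed auto
  then have L1: "(\<lambda>n. integral {0..t} (P (x n i) (u n i))) \<longlonglongrightarrow> L"
    unfolding x_eq' L_def using lim[OF i t] by (intro tendsto_intros)
  \<comment> \<open>Freezing costs at most twice the uniform distance from \<open>x n i\<close> to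
    \<open>X i\<close> times the L1 norm of the control, which is bounded by
    \<open>B\<close>.\<close>
  have "(\<lambda>n. \<phi> (u n) - integral {0..t} (P (x n i) (u n i))) \<longlonglongrightarrow> 0"
  proof (rule LIMSEQ_I)
    fix e :: real assume "e > 0"
    define d where "d = e / (2 * \<bar>B\<bar> + 1)"
    have "d > 0" using \<open>e > 0\<close> by (simp add: d_def)
    have "2 * d * B \<le> d * (2 * \<bar>B\<bar>)" using \<open>d > 0\<close> by simp
    also have "\<dots> < d * (2 * \<bar>B\<bar> + 1)" using \<open>d > 0\<close> by simp
    also have "\<dots> = e" unfolding d_def by simp
    finally have dB: "2 * d * B < e" .
    obtain K where K: "\<And>n s. n \<ge> K \<Longrightarrow> s \<in> {0..T} \<Longrightarrow> norm (x n i s - X i s) < d"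
      using conv[OF i] \<open>d > 0\<close> unfolding uniform_limit_sequentially_iff dist_norm by metis
    have "norm (\<phi> (u n) - integral {0..t} (P (x n i) (u n i))) < e" if "n \<ge> K" for n
    proof -
      note uL = u[OF i, of n]
      have "\<phi> (u n) - integral {0..t} (P (x n i) (u n i))
          = integral {0..t} (\<lambda>s. P (X i) (u n i) s - P (x n i) (u n i) s)"
        unfolding \<phi>_def using P_int[OF X_cont[OF i] uL] P_int[OF x_cont'[OF i] uL]
        by (intro Henstock_Kurzweil_Integration.integral_diff[symmetric]) (auto simp: absolutely_integrable_on_def)
      also have "norm \<dots> \<le> integral {0..t} (\<lambda>s. 2 * d * norm (u n i s))"
      proof (rule norm_integral_le)
        show "(\<lambda>s. P (X i) (u n i) s - P (x n i) (u n i) s) absolutely_integrable_on {0..t}"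
          using P_int[OF X_cont[OF i] uL] P_int[OF x_cont'[OF i] uL] by (intro set_integral_diff)
        show "(\<lambda>s. 2 * d * norm (u n i s)) integrable_on {0..t}"
          using abs_u(2)[OF uL] by (intro integrable_on_mult_right) (auto simp: absolutely_integrable_on_def)
        fix s assume "s \<in> {0..t}"
        then have s: "s \<in> {0..T}" using sub by auto
        have "norm (P (X i) (u n i) s - P (x n i) (u n i) s) \<le> 2 * norm (X i s - x n i s) * norm (u n i s)"
          unfolding P_def using X_sphere[OF i s] sphere[OF i s] by (rule norm_tangent_diff_le)
        also have "\<dots> \<le> 2 * d * norm (u n i s)"
          using K[OF that s] by (intro mult_right_mono) (auto simp: norm_minus_commute)
        finally show "norm (P (X i) (u n i) s - P (x n i) (u n i) s) \<le> 2 * d * norm (u n i s)" .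
      qed
      also have "\<dots> = 2 * d * integral {0..t} (\<lambda>s. norm (u n i s))" by simp
      also have "\<dots> \<le> 2 * d * B"
        using norm_int_le[OF abs_u(1)[OF uL]] bound[OF i, of n] \<open>d > 0\<close> by (intro mult_left_mono) auto
      also have "\<dots> < e" by (rule dB)
      finally show ?thesis .
    qed
    then show "\<exists>K. \<forall>n\<ge>K. norm (\<phi> (u n) - integral {0..t} (P (x n i) (u n i)) - 0) < e" by auto
  qed
  from tendsto_add[OF this L1] have \<phi>_u: "(\<lambda>n. \<phi> (u n)) \<longlonglongrightarrow> L" by simp
  have L2_mid: "L2_on T (f i)" if "f \<in> tail_midpoints u n" for f n
    using tail_midpoints_square_integrable[OF that] u[OF i] by (simp add: L2_on_iff)
  have \<phi>_v: "(\<lambda>k. \<phi> (v k)) \<longlonglongrightarrow> L"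
  proof (rule tail_midpoints_tendsto[OF v \<phi>_u])
    fix n f g assume "f \<in> tail_midpoints u n" "g \<in> tail_midpoints u n"
    note int = this[THEN L2_mid, THEN P_int[OF X_cont[OF i]]]
    have "P (X i) (\<lambda>t. (1/2) *\<^sub>R (f i t + g i t)) = (\<lambda>s. (1/2) *\<^sub>R (P (X i) (f i) s + P (X i) (g i) s))"
      by (simp add: fun_eq_iff P_def algebra_simps inner_add_left)
    then show "\<phi> (\<lambda>i t. (1/2) *\<^sub>R (f i t + g i t)) = (1/2) *\<^sub>R (\<phi> f + \<phi> g)"
      unfolding \<phi>_def using int
      by (simp add: Henstock_Kurzweil_Integration.integral_add absolutely_integrable_on_def)
  qed
  \<comment> \<open>By linearity the difference is the projected integral of
    \<open>v k i - w i\<close>, hence at most twice their L1 distance.\<close>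
  have "(\<lambda>k. \<phi> (v k) - \<phi> w) \<longlonglongrightarrow> 0"
  proof (rule Lim_null_comparison[OF always_eventually tendsto_mult_right_zero[OF vw[OF i], of 2]], rule allI)
    fix k
    note vL = L2_mid[OF v[of k]]
    note int = P_int[OF X_cont[OF i] vL] P_int[OF X_cont[OF i] w[OF i]]
    have d: "(\<lambda>s. v k i s - w i s) absolutely_integrable_on {0..T}"
      using abs_u(1)[OF vL] abs_u(1)[OF w[OF i]] by (intro set_integral_diff)
    then have d': "(\<lambda>s. v k i s - w i s) absolutely_integrable_on {0..t}"
      using absolutely_integrable_on_subinterval sub by blast
    have "\<phi> (v k) - \<phi> w = integral {0..t} (\<lambda>s. P (X i) (v k i) s - P (X i) (w i) s)"
      unfolding \<phi>_def using int
      by (intro Henstock_Kurzweil_Integration.integral_diff[symmetric]) (auto simp: absolutely_integrable_on_def)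
    also have "norm \<dots> \<le> integral {0..t} (\<lambda>s. 2 * norm (v k i s - w i s))"
    proof (rule norm_integral_le)
      show "(\<lambda>s. P (X i) (v k i) s - P (X i) (w i) s) absolutely_integrable_on {0..t}"
        using int by (intro set_integral_diff)
      show "(\<lambda>s. 2 * norm (v k i s - w i s)) integrable_on {0..t}"
        using d' by (intro integrable_on_mult_right) (auto simp: absolutely_integrable_on_def)
      fix s assume "s \<in> {0..t}"
      then have "norm (X i s) = 1" using X_sphere[OF i] sub by auto
      from norm_tangent_le[OF this, of "v k i s - w i s"]
      show "norm (P (X i) (v k i) s - P (X i) (w i) s) \<le> 2 * norm (v k i s - w i s)"
        by (simp add: P_def algebra_simps inner_diff_left)
    qed
    also have "\<dots> \<le> 2 * (\<integral>s. norm (v k i s - w i s) \<partial>lebesgue_on {0..T})"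
      using norm_int_le[OF d] by simp
    finally show "norm (\<phi> (v k) - \<phi> w) \<le> 2 * (\<integral>s. norm (v k i s - w i s) \<partial>lebesgue_on {0..T})" .
  qed
  from tendsto_diff[OF \<phi>_v this] have "(\<lambda>k. \<phi> w) \<longlonglongrightarrow> L" by simp
  then have \<phi>_w: "\<phi> w = L" by (simp add: LIMSEQ_const_iff)
  have rhs_w: "rhs \<kappa> N w X i = (\<lambda>s. coupling \<kappa> N X i s + P (X i) (w i) s)"
    by (simp add: fun_eq_iff rhs_eq P_def)
  note int = coupl_int[OF X_cont] P_int[OF X_cont[OF i] w[OF i]]
  show "rhs \<kappa> N w X i absolutely_integrable_on {0..t}"
    unfolding rhs_w using int by (intro set_integral_add)
  have "integral {0..t} (rhs \<kappa> N w X i) = integral {0..t} (coupling \<kappa> N X i) + \<phi> w"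
    unfolding rhs_w \<phi>_def using int
    by (intro Henstock_Kurzweil_Integration.integral_add) (auto simp: absolutely_integrable_on_def)
  then show "X i t = x0 i + integral {0..t} (rhs \<kappa> N w X i)"
    by (simp add: \<phi>_w L_def)
qed

section \<open>Existence of a minimizer\<close>

lemma stationary_solution:
  fixes x0 :: "nat \<Rightarrow> 'a::euclidean_space"
  assumes "T > 0" and x0: "\<forall>i<N. norm (x0 i) = 1"
  obtains u :: "nat \<Rightarrow> real \<Rightarrow> 'a" and x where "\<forall>i<N. L2_on T (u i)" "is_solution \<kappa> N T x0 u x"
proof -
  \<comment> \<open>One constant vector serves all points: the coupling at \<open>x0 i\<close>
    subtracts from \<open>(\<kappa> / N) *\<^sub>R (\<Sum>k<N. x0 k)\<close> its part along
    \<open>x0 i\<close>, and the control term does the same to the opposite vector.\<close>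
  define u where "u i t = - (\<kappa> / real N) *\<^sub>R (\<Sum>k<N. x0 k)" for i :: nat and t :: real
  have rhs: "rhs \<kappa> N u (\<lambda>i t. x0 i) i = (\<lambda>s. 0)" for i
    by (simp add: fun_eq_iff rhs_def u_def sum_subtractf inner_sum_left inner_sum_right algebra_simps
        inner_commute flip: scaleR_sum_left)
  have "is_solution \<kappa> N T x0 u (\<lambda>i t. x0 i)"
    unfolding is_solution_integral_iff rhs using x0 by auto
  moreover have "L2_on T (u i)" for i
    unfolding L2_on_def u_def integrable_lebesgue_on_iff by (auto intro: absolutely_integrable_continuous_real)
  ultimately show ?thesis using that by blast
qed

theorem theorem2p4:
  fixes N :: nat and \<kappa> T lam :: real and x0 :: "nat \<Rightarrow> 'a::euclidean_space"
  assumes "N \<ge> 1" and "DIM('a) \<ge> 2" and "\<kappa> \<ge> 0" and "T > 0" and "lam > 0"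
    and "\<forall>i<N. norm (x0 i) = 1"
  shows "\<exists>ustar xstar.
           (\<forall>i<N. L2_on T (ustar i)) \<and> is_solution \<kappa> N T x0 ustar xstar \<and>
           (\<forall>u x. (\<forall>i<N. L2_on T (u i)) \<and> is_solution \<kappa> N T x0 u x \<longrightarrow>
                  cost N T lam ustar xstar \<le> cost N T lam u x)"
proof -
  let ?M = "lebesgue_on {0..T}"
  let ?E = "energy ?M {..<N} :: (nat \<Rightarrow> real \<Rightarrow> 'a) \<Rightarrow> real"
  interpret finite_measure ?M by (rule finite_measure_Icc)
  have T: "T \<ge> 0" using \<open>T > 0\<close> by simp
  define A where "A = {(u, x). (\<forall>i<N. L2_on T (u i)) \<and> is_solution \<kappa> N T x0 u x}"
  define J where "J = (\<lambda>(u, x :: nat \<Rightarrow> real \<Rightarrow> 'a). cost N T lam u x)"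
  have A_cost: "J (u, x) = dispersion N T x + lam / N * ?E u" if "(u, x) \<in> A" for u x
    using that cost_eq[of N T u x lam] by (auto simp: A_def J_def is_solution_def)
  have lamN: "lam / N > 0" using assms by simp
  have J_nonneg: "J p \<ge> 0" if "p \<in> A" for p
  proof (cases p)
    case (Pair u x)
    show ?thesis
      using A_cost[of u x] that Pair lamN dispersion_nonneg[of N T x] energy_nonneg[of ?M "{..<N}" u]
      by (metis add_nonneg_nonneg less_imp_le mult_nonneg_nonneg)
  qed
  have "A \<noteq> {}"
  proof -
    obtain u x where "\<forall>i<N. L2_on T (u i)" "is_solution \<kappa> N T x0 u x"
      by (rule stationary_solution[OF \<open>T > 0\<close> assms(6)])
    then have "(u, x) \<in> A" by (simp add: A_def)
    then show ?thesis by blast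
  qed
  have bdd: "bdd_below (J ` A)" using J_nonneg by (intro bdd_belowI[of _ 0]) auto
  define c where "c = Inf (J ` A)"
  have c_le: "c \<le> J p" if "p \<in> A" for p
    unfolding c_def using bdd that by (intro cInf_lower) auto
  have "\<exists>p\<in>A. J p < c + 1 / Suc n" for n :: nat
    using cInf_lessD[of "J ` A" "c + 1 / Suc n"] \<open>A \<noteq> {}\<close> by (auto simp: c_def)
  then obtain p where p: "\<And>n. p n \<in> A" "\<And>n. J (p n) < c + 1 / Suc n" by metis
  define u0 where "u0 n = fst (p n)" for n
  define y where "y n = snd (p n)" for n
  have A: "(u0 n, y n) \<in> A" for n using p(1) by (simp add: u0_def y_def)
  then have u0: "\<forall>i<N. L2_on T (u0 n i)" and y: "is_solution \<kappa> N T x0 (u0 n) (y n)" for n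
    by (auto simp: A_def)
  have J_lim: "(\<lambda>n. J (u0 n, y n)) \<longlonglongrightarrow> c"
  proof (rule tendsto_sandwich[OF _ _ tendsto_const])
    show "(\<lambda>n. c + 1 / Suc n) \<longlonglongrightarrow> c"
      using tendsto_add[OF tendsto_const LIMSEQ_Suc[OF lim_1_over_n], of c] by simp
    show "\<forall>\<^sub>F n in sequentially. c \<le> J (u0 n, y n)" using c_le A by simp
    show "\<forall>\<^sub>F n in sequentially. J (u0 n, y n) \<le> c + 1 / Suc n"
      using p(2) by (auto simp: u0_def y_def intro!: always_eventually less_imp_le)
  qed
  \<comment> \<open>Every cost in the minimizing sequence is at most \<open>c + 1\<close>; dropping
    the nonnegative dispersion leaves this bound on the energy.\<close>
  define E0 where "E0 = (c + 1) / (lam / N)"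
  have E0: "?E (u0 n) \<le> E0" for n
  proof -
    have "lam / N * ?E (u0 n) \<le> J (u0 n, y n)"
      using A_cost[OF A, of n] dispersion_nonneg[of N T "y n"] by simp
    also have "\<dots> \<le> c + 1 / Suc n" using p(2)[of n] by (simp add: u0_def y_def)
    also have "\<dots> \<le> c + 1" by simp
    finally show ?thesis using lamN unfolding E0_def by (simp only: pos_le_divide_eq mult.commute)
  qed
  have y_sphere: "norm (y n i t) = 1" if "i < N" "t \<in> {0..T}" for n i t
    using is_solution_sphere[OF y T u0] assms that by blast
  have y_cont: "continuous_on {0..T} (y n i)" if "i < N" for n i
    using y that by (auto simp: is_solution_def)
  have E0_nonneg: "E0 \<ge> 0" using E0[of 0] energy_nonneg[of ?M "{..<N}" "u0 0"] by linarith
  have equicont: "\<exists>d>0. \<forall>n s. s \<in> {0..T} \<and> norm (t - s) < d \<longrightarrow> norm (y n i t - y n i s) < e"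
    if i: "i < N" and t: "t \<in> {0..T}" and "e > 0" for i t e
  proof -
    \<comment> \<open>Makes the energy term at most \<open>e / 2\<close> for every \<open>n\<close>;
      the time step \<open>e / (2 * C)\<close> takes care of the other half. The added 1 avoids
      division by 0.\<close>
    define \<eta> where "\<eta> = e / (2 * (E0 + 1))"
    have \<eta>: "\<eta> > 0" using \<open>e > 0\<close> E0_nonneg by (simp add: \<eta>_def)
    define C where "C = 2 * \<kappa> + 1 / \<eta>"
    have C: "C > 0" using \<eta> \<open>\<kappa> \<ge> 0\<close> by (simp add: C_def add_nonneg_pos)
    have inc: "norm (y n i b - y n i a) < e"
      if "a \<in> {0..T}" "b \<in> {0..T}" "a \<le> b" "b - a < e / (2 * C)" for a b n
    proof -
      have "norm (y n i b - y n i a) \<le> C * (b - a) + \<eta> * ?E (u0 n)"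
        unfolding C_def using y_sphere that i \<eta> \<open>\<kappa> \<ge> 0\<close>
        by (intro is_solution_increment[OF y u0]) auto
      also have "\<dots> < e / 2 + e / 2"
      proof (rule add_less_le_mono)
        show "C * (b - a) < e / 2" using that C by (simp add: field_simps)
        have "\<eta> * ?E (u0 n) \<le> \<eta> * (E0 + 1)" using E0[of n] \<eta> by (intro mult_left_mono) auto
        also have "\<dots> = e / 2" using E0_nonneg by (simp add: \<eta>_def field_simps)
        finally show "\<eta> * ?E (u0 n) \<le> e / 2" .
      qed
      finally show ?thesis by simp
    qed
    show ?thesis
    proof (intro exI[of _ "e / (2 * C)"] conjI allI impI)
      fix n s assume s: "s \<in> {0..T} \<and> norm (t - s) < e / (2 * C)"
      then have d: "t - s < e / (2 * C)" "s - t < e / (2 * C)"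
        by (auto simp: abs_less_iff)
      show "norm (y n i t - y n i s) < e"
      proof (cases "s \<le> t")
        case True
        with inc[of s t] s t d show ?thesis by simp
      next
        case False
        with inc[of t s] s t d show ?thesis by (simp add: norm_minus_commute)
      qed
    qed (use \<open>e > 0\<close> C in simp)
  qed
  obtain X r where r: "strict_mono (r :: nat \<Rightarrow> nat)" and X: "\<And>i. i < N \<Longrightarrow> continuous_on {0..T} (X i)"
    and unif: "\<And>i. i < N \<Longrightarrow> uniform_limit {0..T} (\<lambda>n. y (r n) i) (X i) sequentially"
  proof (rule Arzela_Ascoli_family)
    show "compact {0..T}" by simp
    show "norm (y n i t) \<le> 1" if "i < N" "t \<in> {0..T}" for n i t
      using y_sphere[OF that] by simp
    show "\<exists>d>0. \<forall>n s. s \<in> {0..T} \<and> norm (t - s) < d \<longrightarrow> norm (y n i t - y n i s) < e"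
      if "i < N" "t \<in> {0..T}" "0 < e" for i t e
      using that by (rule equicont)
  qed (rule that)
  define u where "u n = u0 (r n)" for n
  have u: "L2_on T (u n i)" if "i < N" for n i using u0 that by (simp add: u_def)
  have conv: "(\<lambda>n. y (r n) i t) \<longlonglongrightarrow> X i t" if "i < N" "t \<in> {0..T}" for i t
    by (rule tendsto_uniform_limitI[OF unif[OF that(1)] that(2)])
  have disp: "(\<lambda>n. dispersion N T (y (r n))) \<longlonglongrightarrow> dispersion N T X"
    by (rule dispersion_tendsto) (use y_cont y_sphere conv in auto)
  \<comment> \<open>The cost formula solved for the energy, with cost and dispersion replaced by
    their limits; consequently dispersion of \<open>X\<close> plus \<open>lam / N * q\<close> is
    exactly \<open>c\<close>.\<close>
  define q where "q = (c - dispersion N T X) / (lam / N)"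
  have "(\<lambda>n. (J (u n, y (r n)) - dispersion N T (y (r n))) / (lam / N)) \<longlonglongrightarrow> q"
    unfolding q_def u_def using LIMSEQ_subseq_LIMSEQ[OF J_lim r] disp lamN
    using \<open>N \<ge> 1\<close> by (intro tendsto_intros) (auto simp: o_def)
  moreover have "(J (u n, y (r n)) - dispersion N T (y (r n))) / (lam / N) = ?E (u n)" for n
    unfolding u_def A_cost[OF A] using \<open>N \<ge> 1\<close> \<open>lam > 0\<close> by simp
  ultimately have E_lim: "(\<lambda>n. ?E (u n)) \<longlonglongrightarrow> q" by simp
  obtain v w where v: "\<And>k. v k \<in> tail_midpoints u k" and w: "\<And>i. i < N \<Longrightarrow> L2_on T (w i)"
    and E_w: "?E w \<le> q"
    and vw: "\<And>i. i < N \<Longrightarrow> (\<lambda>k. \<integral>t. norm (v k i t - w i t) \<partial>?M) \<longlonglongrightarrow> 0"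
  proof (rule weak_compactness[OF finite_lessThan _ E_lim])
    show "square_integrable ?M (u n i)" if "i \<in> {..<N}" for n i
      using u that by (simp add: L2_on_iff)
  qed (rule that, simp_all add: L2_on_iff)
  \<comment> \<open>Young's inequality with weight 1; only uniformity in \<open>n\<close> matters
    here.\<close>
  have bound: "(\<integral>t. norm (u n i t) \<partial>?M) \<le> (E0 + measure ?M (space ?M)) / 2" if "i < N" for n i
  proof -
    have "(\<integral>t. norm (u n i t) \<partial>?M) \<le> ((\<integral>t. (norm (u n i t))\<^sup>2 \<partial>?M) / 1 + 1 * measure ?M (space ?M)) / 2"
      using u[OF that, of n] by (intro integral_norm_le_square) (auto simp: L2_on_iff)
    moreover have "(\<integral>t. (norm (u n i t))\<^sup>2 \<partial>?M) \<le> E0"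
      using energy_component_le[of "{..<N}" i ?M "u n"] E0[of "r n"] that by (simp add: u_def)
    ultimately show ?thesis by simp
  qed
  have sol: "is_solution \<kappa> N T x0 w X"
  proof (rule is_solution_limit[OF T \<open>\<kappa> \<ge> 0\<close> _ _ bound _ X unif v w vw])
    show "is_solution \<kappa> N T x0 (u n) (y (r n))" for n using y by (simp add: u_def)
  qed (use u y_sphere in auto)
  have "cost N T lam w X \<le> cost N T lam u' x'"
    if "(\<forall>i<N. L2_on T (u' i)) \<and> is_solution \<kappa> N T x0 u' x'" for u' x'
  proof -
    have "cost N T lam w X = dispersion N T X + lam / N * ?E w"
      using w X by (intro cost_eq) auto
    also have "\<dots> \<le> dispersion N T X + lam / N * q"
      using E_w lamN by (intro add_left_mono mult_left_mono) auto
    also have "\<dots> = c" using \<open>N \<ge> 1\<close> \<open>lam > 0\<close> by (simp add: q_def)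
    also have "\<dots> \<le> cost N T lam u' x'"
      using c_le[of "(u', x')"] that by (simp add: A_def J_def)
    finally show ?thesis .
  qed
  with w sol show ?thesis by blast
qed

end
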